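(* There is an absolute constant $C_0>0$ such that the following holds. Let $q$ be a prime power, let $k,n\ge 1$ be integers, let $N=q^k$, and let $L$ be an integer with $1\le L\le N$. Let $\mathcal{C}\subseteq\mathbb{F}_q^n$ be a random linear code with independent symbols, i.e. $\mathcal{C}$ is given by a random generator matrix $G\in\mathbb{F}_q^{k\times n}$ whose columns are independent random vectors in $\mathbb{F}_q^k$ (not necessarily identically distributed), with encoding map $c(x)=x^TG$ for $x\in\mathbb{F}_q^k$. Let $$\mathcal{E}=\max_{\Lambda\subset\mathbb{F}_q^k,\ |\Lambda|=L}\ \mathbb{E}_{\mathcal{C}}\ \max_{z\in\mathbb{F}_q^n}\left(\sum_{x\in\Lambda}\mathrm{agr}(c(x),z)\right).$$ Then $$\mathbb{E}_{\mathcal{C}}\ \max_{z\in\mathbb{F}_q^n}\ \max_{\Lambda\subset\mathbb{F}_q^k,\ |\Lambda|=L}\ \sum_{x\in\Lambda}\mathrm{agr}(c(x),z)\ \le\ \mathcal{E}+Y+\sqrt{\mathcal{E}\,Y},$$ where $Y=C_0\,L\,\log(N)\,\log^5(L)$.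
   Context: For $u,v\in\mathbb{F}_q^n$, $\mathrm{agr}(u,v)$ is the number of coordinates $j\in\{1,\dots,n\}$ with $u_j=v_j$. $\log$ is the logarithm base $2$ and $\log^5(L)=(\log L)^5$. $\mathbb{E}_{\mathcal{C}}$ denotes expectation over the random generator matrix $G$. "Absolute constant" means independent of $q,k,n,L$ and of the distribution of $G$. *)

theory Defs
  imports "HOL-Algebra.Ring" "HOL-Number_Theory.Prime_Powers" "HOL-Probability.Probability"
begin

text \<open>
  Fields are carrier-based, since a constant existentially quantified inside a proposition
  would depend on a type variable ranging over fields. Quantifying over fields whose carrier
  is a finite set of natural numbers covers all finite fields up to isomorphism.
  Vectors of length \<open>m\<close> are extensional functions on \<open>{1..m}\<close>, so that
  equality of vectors and cardinalities of sets of vectors are the usual ones.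
\<close>

definition vectors :: "('a, 'b) ring_scheme \<Rightarrow> nat \<Rightarrow> (nat \<Rightarrow> 'a) set" where
  "vectors F m = {1..m} \<rightarrow>\<^sub>E carrier F"

definition matrices :: "('a, 'b) ring_scheme \<Rightarrow> nat \<Rightarrow> nat \<Rightarrow> (nat \<Rightarrow> nat \<Rightarrow> 'a) set" where
  "matrices F k n = {1..k} \<rightarrow>\<^sub>E vectors F n"

definition mat_col :: "nat \<Rightarrow> (nat \<Rightarrow> nat \<Rightarrow> 'a) \<Rightarrow> nat \<Rightarrow> (nat \<Rightarrow> 'a)" where
  "mat_col k G j = (\<lambda>i\<in>{1..k}. G i j)"

definition encode ::
  "('a, 'b) ring_scheme \<Rightarrow> nat \<Rightarrow> nat \<Rightarrow> (nat \<Rightarrow> nat \<Rightarrow> 'a) \<Rightarrow> (nat \<Rightarrow> 'a) \<Rightarrow> (nat \<Rightarrow> 'a)" where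
  "encode F k n G x = (\<lambda>j\<in>{1..n}. finsum F (\<lambda>i. x i \<otimes>\<^bsub>F\<^esub> G i j) {1..k})"

definition agr :: "nat \<Rightarrow> (nat \<Rightarrow> 'a) \<Rightarrow> (nat \<Rightarrow> 'a) \<Rightarrow> nat" where
  "agr n u v = card {j \<in> {1..n}. u j = v j}"

text \<open>
  A random generator matrix is given by its law \<open>P\<close>. As it takes values in the finite set
  of \<open>k \<times> n\<close> matrices, the law is discrete, and the random variables are the columns
  under \<open>P\<close>; nothing is assumed about their individual distributions.
\<close>

definition indep_symbols_law ::
  "('a, 'b) ring_scheme \<Rightarrow> nat \<Rightarrow> nat \<Rightarrow> (nat \<Rightarrow> nat \<Rightarrow> 'a) pmf \<Rightarrow> bool" where
  "indep_symbols_law F k n P \<longleftrightarrow>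
     set_pmf P \<subseteq> matrices F k n \<and>
     prob_space.indep_vars (measure_pmf P) (\<lambda>_. count_space UNIV) (\<lambda>j G. mat_col k G j) {1..n}"

definition message_sets ::
  "('a, 'b) ring_scheme \<Rightarrow> nat \<Rightarrow> nat \<Rightarrow> (nat \<Rightarrow> 'a) set set" where
  "message_sets F k L = {\<Lambda>. \<Lambda> \<subseteq> vectors F k \<and> card \<Lambda> = L}"

definition total_agr ::
  "('a, 'b) ring_scheme \<Rightarrow> nat \<Rightarrow> nat \<Rightarrow> (nat \<Rightarrow> nat \<Rightarrow> 'a) \<Rightarrow> (nat \<Rightarrow> 'a) set \<Rightarrow> (nat \<Rightarrow> 'a) \<Rightarrow> nat" where
  "total_agr F k n G \<Lambda> z = (\<Sum>x\<in>\<Lambda>. agr n (encode F k n G x) z)"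

definition max_expected_agr ::
  "('a, 'b) ring_scheme \<Rightarrow> nat \<Rightarrow> nat \<Rightarrow> nat \<Rightarrow> (nat \<Rightarrow> nat \<Rightarrow> 'a) pmf \<Rightarrow> real" where
  "max_expected_agr F k n L P =
     (MAX \<Lambda>\<in>message_sets F k L.
        measure_pmf.expectation P (\<lambda>G. real (MAX z\<in>vectors F n. total_agr F k n G \<Lambda> z)))"

definition expected_max_agr ::
  "('a, 'b) ring_scheme \<Rightarrow> nat \<Rightarrow> nat \<Rightarrow> nat \<Rightarrow> (nat \<Rightarrow> nat \<Rightarrow> 'a) pmf \<Rightarrow> real" where
  "expected_max_agr F k n L P =
     measure_pmf.expectation P
       (\<lambda>G. real (MAX z\<in>vectors F n. MAX \<Lambda>\<in>message_sets F k L. total_agr F k n G \<Lambda> z))"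

end

theory Submission
  imports Defs
begin

text \<open>
  For a fixed message set the best \<open>z\<close> is found coordinate by coordinate, so the total agreement is
  the sum over \<open>j\<close> of the plurality: the largest number of messages whose codewords share
  their \<open>j\<close>-th symbol. Since the columns are independent, symmetrization reduces the claim to a
  Rademacher process indexed by the message sets, with the code fixed.

  That process is bounded by chaining over random subsamples. A sample \<open>y\<close> of size
  \<open>m\<^sub>i = L div 2^i\<close> drawn from \<open>\<Lambda>\<close> with replacement, rescaled by \<open>w\<^sub>i = L / m\<^sub>i\<close>, reproduces the
  pluralities of \<open>\<Lambda>\<close>, truncated below at \<open>w\<^sub>i s\<close> with \<open>s\<close> of order \<open>log L\<close>, up to a squared
  \<open>l\<^sup>2\<close>-error \<open>O(w\<^sub>i s Q)\<close>, where \<open>Q\<close> is the largest sum of pluralities. There are at most \<open>N^(m\<^sub>i)\<close>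
  samples and \<open>m\<^sub>i w\<^sub>i = L\<close>, so each of the \<open>log L\<close> levels contributes \<open>O(sqrt (L s Q log N))\<close>.
  Averaging over the code gives \<open>Q \<le> E + sqrt (Y Q)\<close> for the expectation of \<open>Q\<close>, which is solved for \<open>Q\<close>.
\<close>

subsection \<open>Plurality\<close>

text \<open>
  The maximum ranges over all values, also those not taken by \<open>u\<close>; this only adds counts \<open>0\<close>.
\<close>

definition plurality :: "'i set \<Rightarrow> ('i \<Rightarrow> 'b) \<Rightarrow> nat" where
  "plurality I u = Max (range (\<lambda>\<alpha>. card {i \<in> I. u i = \<alpha>}))"

lemma finite_range_counts:
  assumes "finite I"
  shows "finite (range (\<lambda>\<alpha>. card {i \<in> I. u i = \<alpha>}))"
  by (rule finite_subset[of _ "{..card I}"]) (auto intro!: card_mono assms)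

lemma count_le_plurality:
  assumes "finite I"
  shows "card {i \<in> I. u i = \<alpha>} \<le> plurality I u"
  unfolding plurality_def by (rule Max_ge) (use finite_range_counts[OF assms, of u] in auto)

lemma plurality_ge_1:
  assumes "finite I" "I \<noteq> {}"
  shows "1 \<le> plurality I u"
proof -
  obtain i where i: "i \<in> I" using assms by auto
  have "card {i' \<in> I. u i' = u i} \<noteq> 0" using assms i by auto
  then show ?thesis using count_le_plurality[OF assms(1), of u "u i"] by linarith
qed

text \<open>Since the maximum is positive, the maximiser is a value taken on \<open>I\<close>. Union
  bounds can thus run over at most \<open>card I\<close> values, and optimal symbols stay inside the
  field.\<close>

lemma plurality_attained:
  assumes "finite I" "I \<noteq> {}"
  obtains \<alpha> where "\<alpha> \<in> u ` I" "card {i \<in> I. u i = \<alpha>} = plurality I u"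
proof -
  have "plurality I u \<in> range (\<lambda>\<alpha>. card {i \<in> I. u i = \<alpha>})"
    unfolding plurality_def by (rule Max_in) (use finite_range_counts[OF assms(1), of u] in auto)
  then obtain \<alpha> where \<alpha>: "plurality I u = card {i \<in> I. u i = \<alpha>}" by auto
  have "{i \<in> I. u i = \<alpha>} \<noteq> {}"
    using plurality_ge_1[OF assms, of u] \<alpha> by (metis card.empty not_one_le_zero)
  then have "\<alpha> \<in> u ` I" by auto
  with that \<alpha> show thesis by auto
qed

lemma plurality_le_card:
  assumes "finite I"
  shows "plurality I u \<le> card I"
  unfolding plurality_def using finite_range_counts[OF assms, of u]
  by (subst Max_le_iff) (auto intro!: card_mono assms)

lemma plurality_cong:
  assumes "\<And>i. i \<in> I \<Longrightarrow> u i = v i"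
  shows "plurality I u = plurality I v"
proof -
  have "{i \<in> I. u i = \<alpha>} = {i \<in> I. v i = \<alpha>}" for \<alpha> using assms by auto
  then show ?thesis by (simp add: plurality_def)
qed

text \<open>Serves level \<open>0\<close> of the chain, where the sample enumerates the message set
  and must return its exact plurality.\<close>

lemma plurality_bij:
  assumes "bij_betw b A B"
  shows "plurality A (u \<circ> b) = plurality B u"
proof -
  have "card {i \<in> A. (u \<circ> b) i = \<alpha>} = card {i \<in> B. u i = \<alpha>}" for \<alpha>
  proof (rule bij_betw_same_card[of b])
    show "bij_betw b {i \<in> A. (u \<circ> b) i = \<alpha>} {i \<in> B. u i = \<alpha>}"
      using assms by (auto simp: bij_betw_def inj_on_def)
  qed
  then show ?thesis by (simp add: plurality_def)
qed

subsection \<open>Rademacher processes\<close>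

text \<open>A sign pattern is encoded by the set of its positive coordinates, so that averages over
  signs are finite sums over \<open>Pow J\<close>.\<close>

definition sgn_of :: "'j set \<Rightarrow> 'j \<Rightarrow> real" where
  "sgn_of S j = (if j \<in> S then 1 else - 1)"

definition rademacher_max :: "'j set \<Rightarrow> 't set \<Rightarrow> ('t \<Rightarrow> 'j \<Rightarrow> real) \<Rightarrow> real" where
  "rademacher_max J T a =
     (\<Sum>S\<in>Pow J. MAX t\<in>T. \<Sum>j\<in>J. sgn_of S j * a t j) / 2 ^ card J"

text \<open>Termwise comparison of power series, resting on
  \<open>2 ^ n * fact n \<le> fact (2 * n)\<close>.\<close>

lemma cosh_le_exp_half_square: "cosh (x::real) \<le> exp (x\<^sup>2 / 2)"
proof -
  have fact_le: "2 ^ n * fact n \<le> (fact (2 * n) :: real)" for n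
  proof (induction n)
    case (Suc n)
    have "2 ^ Suc n * fact (Suc n) = 2 * (1 + real n) * (2 ^ n * fact n)" by simp
    also have "\<dots> \<le> (2 * real n + 2) * (2 * real n + 1) * fact (2 * n)"
      by (intro mult_mono Suc.IH) (auto simp: algebra_simps)
    also have "\<dots> = fact (2 * Suc n)" by (simp add: algebra_simps)
    finally show ?case .
  qed simp
  have "(\<lambda>n. if even n then x ^ n /\<^sub>R fact n else 0) sums cosh x" by (rule cosh_converges)
  then have "(\<lambda>n. x ^ (2 * n) /\<^sub>R fact (2 * n)) sums cosh x"
    by (subst (asm) sums_mono_reindex[of "\<lambda>n. 2 * n", symmetric])
       (auto simp: strict_mono_def elim!: evenE)
  moreover have "(\<lambda>n. (x\<^sup>2 / 2) ^ n /\<^sub>R fact n) sums exp (x\<^sup>2 / 2)" by (rule exp_converges)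
  moreover have "x ^ (2 * n) /\<^sub>R fact (2 * n) \<le> (x\<^sup>2 / 2) ^ n /\<^sub>R fact n" for n
  proof -
    have "(x\<^sup>2) ^ n / fact (2 * n) \<le> (x\<^sup>2) ^ n / (2 ^ n * fact n)"
      by (intro divide_left_mono fact_le) auto
    moreover have "x ^ (2 * n) /\<^sub>R fact (2 * n) = (x\<^sup>2) ^ n / fact (2 * n)"
      by (simp only: power_mult) (simp add: divide_inverse mult.commute)
    moreover have "(x\<^sup>2 / 2) ^ n /\<^sub>R fact n = (x\<^sup>2) ^ n / (2 ^ n * fact n)"
      by (simp only: power_divide) (simp add: field_simps)
    ultimately show ?thesis by (simp only:)
  qed
  ultimately show ?thesis by (rule sums_le[rotated])
qed

text \<open>Independence of the signs: expanding the product chooses \<open>exp (b j)\<close> on a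
  subset \<open>S\<close> and \<open>exp (- b j)\<close> off it.\<close>

lemma sum_signs_exp:
  assumes "finite J"
  shows "(\<Sum>S\<in>Pow J. exp (\<Sum>j\<in>J. sgn_of S j * b j)) = (\<Prod>j\<in>J. exp (b j) + exp (- b j :: real))"
proof -
  have "(\<Prod>j\<in>J. exp (b j) + exp (- b j)) = (\<Sum>S\<in>Pow J. (\<Prod>j\<in>S. exp (b j)) * (\<Prod>j\<in>J - S. exp (- b j)))"
    using assms by (rule prod_add)
  also have "\<dots> = (\<Sum>S\<in>Pow J. exp (\<Sum>j\<in>J. sgn_of S j * b j))"
  proof (rule sum.cong)
    fix S assume S: "S \<in> Pow J"
    then have fS: "finite S" "S \<subseteq> J" using assms finite_subset by auto
    have "(\<Prod>j\<in>S. exp (b j)) * (\<Prod>j\<in>J - S. exp (- b j)) =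
        (\<Prod>j\<in>S. exp (sgn_of S j * b j)) * (\<Prod>j\<in>J - S. exp (sgn_of S j * b j))"
      by (intro arg_cong2[of _ _ _ _ "(*)"] prod.cong) (auto simp: sgn_of_def)
    also have "\<dots> = (\<Prod>j\<in>J. exp (sgn_of S j * b j))"
      by (subst prod.subset_diff[OF fS(2) assms]) (rule mult.commute)
    finally show "(\<Prod>j\<in>S. exp (b j)) * (\<Prod>j\<in>J - S. exp (- b j)) = exp (\<Sum>j\<in>J. sgn_of S j * b j)"
      using assms by (simp add: exp_sum)
  qed simp
  finally show ?thesis by simp
qed

text \<open>Massart's finite class bound before optimising \<open>lam\<close>: a maximum of
  exponentials is at most their sum, and each averages to at most
  \<open>exp (lam\<^sup>2 * V / 2)\<close>. Taking a bound \<open>M\<close> in place of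
  \<open>card T\<close> covers one-element families, where \<open>ln (card T) = 0\<close> would give
  a degenerate optimal \<open>lam\<close>.\<close>

lemma rademacher_max_le_linear:
  assumes J: "finite J" and T: "finite T" "T \<noteq> {}" and V: "\<And>t. t \<in> T \<Longrightarrow> (\<Sum>j\<in>J. (a t j)\<^sup>2) \<le> V"
    and M: "real (card T) \<le> M" "0 < M" and lam: "0 < lam"
  shows "rademacher_max J T a \<le> ln M / lam + lam * V / 2"
proof -
  define c where "c = ln M + lam\<^sup>2 * V / 2"
  define X where "X S = (MAX t\<in>T. \<Sum>j\<in>J. sgn_of S j * a t j)" for S
  \<comment> \<open>The tangent bound \<open>x \<le> exp (x - c) + c - 1\<close> plays the role of Jensen's inequality;
    the choice of \<open>c\<close> makes it sharp after averaging.\<close>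
  have X: "lam * X S \<le> c - 1 + exp (- c) * (\<Sum>t\<in>T. exp (\<Sum>j\<in>J. sgn_of S j * (lam * a t j)))" for S
  proof -
    have "X S \<in> (\<lambda>t. \<Sum>j\<in>J. sgn_of S j * a t j) ` T"
      unfolding X_def using T by (intro Max_in) auto
    then obtain t where t: "t \<in> T" "X S = (\<Sum>j\<in>J. sgn_of S j * a t j)" by auto
    have "lam * X S = (\<Sum>j\<in>J. sgn_of S j * (lam * a t j))"
      unfolding t(2) by (simp add: sum_distrib_left algebra_simps)
    also have "exp \<dots> \<le> (\<Sum>t\<in>T. exp (\<Sum>j\<in>J. sgn_of S j * (lam * a t j)))"
      using T t(1) by (intro member_le_sum) auto
    finally have le: "exp (lam * X S) \<le> (\<Sum>t\<in>T. exp (\<Sum>j\<in>J. sgn_of S j * (lam * a t j)))" .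
    have "lam * X S - c + 1 \<le> exp (lam * X S - c)"
      using exp_ge_add_one_self[of "lam * X S - c"] by linarith
    also have "\<dots> = exp (- c) * exp (lam * X S)" by (simp add: exp_diff exp_minus field_simps)
    also have "\<dots> \<le> exp (- c) * (\<Sum>t\<in>T. exp (\<Sum>j\<in>J. sgn_of S j * (lam * a t j)))"
      by (intro mult_left_mono le) auto
    finally show ?thesis by simp
  qed
  have E: "(\<Sum>S\<in>Pow J. exp (\<Sum>j\<in>J. sgn_of S j * (lam * a t j))) \<le> 2 ^ card J * exp (lam\<^sup>2 * V / 2)"
    if "t \<in> T" for t
  proof -
    have "(\<Sum>S\<in>Pow J. exp (\<Sum>j\<in>J. sgn_of S j * (lam * a t j))) =
        (\<Prod>j\<in>J. exp (lam * a t j) + exp (- (lam * a t j)))"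
      by (rule sum_signs_exp[OF J])
    also have "\<dots> \<le> (\<Prod>j\<in>J. 2 * exp ((lam * a t j)\<^sup>2 / 2))"
    proof (rule prod_mono)
      fix j
      show "0 \<le> exp (lam * a t j) + exp (- (lam * a t j)) \<and>
        exp (lam * a t j) + exp (- (lam * a t j)) \<le> 2 * exp ((lam * a t j)\<^sup>2 / 2)"
        using cosh_le_exp_half_square[of "lam * a t j"] by (simp add: cosh_field_def add_nonneg_nonneg)
    qed
    also have "\<dots> = 2 ^ card J * exp (\<Sum>j\<in>J. (lam * a t j)\<^sup>2 / 2)"
      using J by (simp add: prod.distrib exp_sum)
    also have "(\<Sum>j\<in>J. (lam * a t j)\<^sup>2 / 2) = lam\<^sup>2 / 2 * (\<Sum>j\<in>J. (a t j)\<^sup>2)"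
      by (simp add: sum_distrib_left power_mult_distrib)
    also have "\<dots> \<le> lam\<^sup>2 / 2 * V" using V[OF that] by (intro mult_left_mono) auto
    finally show ?thesis by simp
  qed
  have "lam * (\<Sum>S\<in>Pow J. X S) = (\<Sum>S\<in>Pow J. lam * X S)" by (rule sum_distrib_left)
  also have "\<dots> \<le> (\<Sum>S\<in>Pow J. c - 1 + exp (- c) * (\<Sum>t\<in>T. exp (\<Sum>j\<in>J. sgn_of S j * (lam * a t j))))"
    by (intro sum_mono X)
  also have "\<dots> = 2 ^ card J * (c - 1) +
      exp (- c) * (\<Sum>t\<in>T. \<Sum>S\<in>Pow J. exp (\<Sum>j\<in>J. sgn_of S j * (lam * a t j)))"
    using J by (subst sum.swap) (simp add: sum.distrib sum_distrib_left card_Pow del: sum_constant_scaleR)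
  also have "(\<Sum>t\<in>T. \<Sum>S\<in>Pow J. exp (\<Sum>j\<in>J. sgn_of S j * (lam * a t j))) \<le>
      (\<Sum>t\<in>T. 2 ^ card J * exp (lam\<^sup>2 * V / 2))"
    by (intro sum_mono E)
  also have "\<dots> = real (card T) * (2 ^ card J * exp (lam\<^sup>2 * V / 2))" by simp
  also have "\<dots> \<le> M * (2 ^ card J * exp (lam\<^sup>2 * V / 2))" using M by (intro mult_right_mono) auto
  also have "\<dots> = 2 ^ card J * exp c" using M by (simp add: c_def exp_add)
  also have "2 ^ card J * (c - 1) + exp (- c) * (2 ^ card J * exp c) = 2 ^ card J * c"
    by (simp add: exp_minus algebra_simps)
  finally have "lam * (\<Sum>S\<in>Pow J. X S) \<le> 2 ^ card J * c" by simp
  then have "lam * rademacher_max J T a \<le> c"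
    unfolding rademacher_max_def X_def[symmetric] by (simp add: field_simps)
  then have "rademacher_max J T a \<le> c / lam" using lam by (simp add: pos_le_divide_eq mult.commute)
  also have "c / lam = ln M / lam + lam * V / 2"
    using lam by (simp add: c_def add_divide_distrib power2_eq_square)
  finally show ?thesis .
qed

lemma rademacher_max_le:
  assumes "finite J" "finite T" "T \<noteq> {}" "\<And>t. t \<in> T \<Longrightarrow> (\<Sum>j\<in>J. (a t j)\<^sup>2) \<le> V"
    and "real (card T) \<le> M" "1 < M" and "0 < V"
  shows "rademacher_max J T a \<le> sqrt (2 * V * ln M)"
proof -
  \<comment> \<open>Balances the two terms: each becomes \<open>lam * V / 2\<close>.\<close>
  define lam where "lam = sqrt (2 * ln M / V)"
  have lam: "lam > 0" "lam * lam = 2 * ln M / V" using assms by (auto simp: lam_def)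
  have "rademacher_max J T a \<le> ln M / lam + lam * V / 2"
    using assms lam by (intro rademacher_max_le_linear) auto
  also have "\<dots> = lam * V"
  proof -
    have "lam * (lam * V) = 2 * ln M" using lam(2) assms by (simp flip: mult.assoc)
    then have "ln M / lam = lam * V / 2" using lam(1) by (simp add: field_simps)
    then show ?thesis by (simp only:)
  qed
  also have "\<dots> = sqrt (2 * V * ln M)"
  proof (rule real_sqrt_unique[symmetric])
    have "(lam * V)\<^sup>2 = (lam * lam) * V * V" by (simp add: power2_eq_square)
    then show "(lam * V)\<^sup>2 = 2 * V * ln M" using lam assms by simp
  qed (use lam assms in auto)
  finally show ?thesis .
qed

subsection \<open>Sampling with replacement\<close>

text \<open>For negative \<open>x\<close>, put \<open>z = - x\<close> and multiply by
  \<open>exp z\<close>: in the product with its quadratic Taylor polynomial the linear terms cancel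
  and no negative coefficient remains.\<close>

lemma exp_le_quadratic:
  fixes x :: real
  assumes "\<bar>x\<bar> \<le> 1"
  shows "exp x \<le> 1 + x + x\<^sup>2"
proof (cases "x \<ge> 0")
  case True
  then show ?thesis using assms by (intro exp_bound) auto
next
  case False
  define z where "z = - x"
  have z: "0 \<le> z" "z \<le> 1" using False assms by (auto simp: z_def)
  have "1 \<le> 1 + z\<^sup>2 / 2 + z ^ 3 / 2 + z ^ 4 / 2" using z by simp
  also have "\<dots> = (1 - z + z\<^sup>2) * (1 + z + z\<^sup>2 / 2)"
    by (simp add: field_simps power2_eq_square power3_eq_cube power4_eq_xxxx)
  also have "\<dots> \<le> (1 - z + z\<^sup>2) * exp z"
    using z by (intro mult_left_mono exp_lower_Taylor_quadratic) auto
  finally have "1 \<le> (1 - z + z\<^sup>2) * exp z" .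
  then have "exp (- z) \<le> 1 - z + z\<^sup>2" by (simp add: exp_minus field_simps)
  then show ?thesis by (simp add: z_def)
qed

text \<open>Uniform sampling with replacement is written as an unnormalised sum over functions into
  \<open>A\<close>. The draws are independent, so the moment generating function of a count is an
  \<open>m\<close>-th power.\<close>

lemma sum_exp_count:
  fixes u :: "'x \<Rightarrow> 'b"
  assumes "finite A"
  shows "(\<Sum>y\<in>{..<m} \<rightarrow>\<^sub>E A. exp (lam * real (card {t \<in> {..<m}. u (y t) = \<alpha>}))) =
    (\<Sum>x\<in>A. exp (if u x = \<alpha> then lam else 0)) ^ m"
proof -
  have "exp (lam * real (card {t \<in> {..<m}. u (y t) = \<alpha>})) =
      (\<Prod>t\<in>{..<m}. exp (if u (y t) = \<alpha> then lam else 0))" for y :: "nat \<Rightarrow> 'x"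
  proof -
    have "lam * real (card {t \<in> {..<m}. u (y t) = \<alpha>}) = (\<Sum>t\<in>{..<m}. if u (y t) = \<alpha> then lam else 0)"
      by (subst sum.If_cases) (auto simp: Int_def)
    then show ?thesis by (simp add: exp_sum)
  qed
  then show ?thesis
    using prod_sum_PiE[of "{..<m}" "\<lambda>_. A" "\<lambda>_ x. exp (if u x = \<alpha> then lam else 0)"] assms by simp
qed

text \<open>Chernoff bound for a binomial count, by \<open>1 + x \<le> exp x\<close> for a single
  draw and then \<open>exp lam - 1 \<le> lam + lam\<^sup>2\<close>. The exponent scales with the
  mean \<open>\<mu>\<close> rather than with \<open>m\<close>, which later makes squared errors
  linear in the plurality.\<close>

lemma sum_exp_count_deviation_le:
  fixes u :: "'x \<Rightarrow> 'b" and m :: nat and \<alpha> :: 'b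
  assumes A: "finite A" "A \<noteq> {}" and lam: "\<bar>lam\<bar> \<le> 1"
  defines "\<mu> \<equiv> real m * real (card {x \<in> A. u x = \<alpha>}) / real (card A)"
  shows "(\<Sum>y\<in>{..<m} \<rightarrow>\<^sub>E A. exp (lam * (real (card {t \<in> {..<m}. u (y t) = \<alpha>}) - \<mu>)))
    \<le> real (card A) ^ m * exp (lam\<^sup>2 * \<mu>)"
proof -
  define c where "c = real (card {x \<in> A. u x = \<alpha>}) / real (card A)"
  have cA: "real (card A) > 0" using A by (simp add: card_gt_0_iff)
  have "card A = card {x \<in> A. u x = \<alpha>} + card {x \<in> A. u x \<noteq> \<alpha>}"
    using A by (subst card_Un_disjoint[symmetric]) (auto intro!: arg_cong[of _ _ card])
  then have "(\<Sum>x\<in>A. exp (if u x = \<alpha> then lam else 0)) =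
      real (card A) + real (card {x \<in> A. u x = \<alpha>}) * (exp lam - 1)"
    using A by (simp add: if_distrib[of exp] sum.If_cases Int_def algebra_simps flip: Collect_conj_eq)
  also have "\<dots> = real (card A) * (1 + c * (exp lam - 1))"
    using cA by (simp add: c_def field_simps)
  finally have "(\<Sum>y\<in>{..<m} \<rightarrow>\<^sub>E A. exp (lam * real (card {t \<in> {..<m}. u (y t) = \<alpha>}))) =
      (real (card A) * (1 + c * (exp lam - 1))) ^ m"
    by (simp only: sum_exp_count[OF A(1)])
  also have "\<dots> \<le> (real (card A) * exp (c * (exp lam - 1))) ^ m"
  proof (intro power_mono mult_left_mono)
    \<comment> \<open>The base is \<open>card A\<close> times a convex combination of
      \<open>1\<close> and \<open>exp lam\<close>, hence nonnegative, as monotonicity of powers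
      requires.\<close>
    have "c \<le> 1" unfolding c_def using cA A by (auto intro!: card_mono simp: divide_le_eq)
    moreover have "0 \<le> c" by (simp add: c_def)
    moreover have "1 + c * (exp lam - 1) = (1 - c) + c * exp lam" by (simp add: algebra_simps)
    ultimately have "0 \<le> 1 + c * (exp lam - 1)" by (simp only:) simp
    then show "0 \<le> real (card A) * (1 + c * (exp lam - 1))" by simp
  qed (auto simp: exp_ge_add_one_self)
  also have "\<dots> = real (card A) ^ m * exp (\<mu> * (exp lam - 1))"
    by (simp add: power_mult_distrib \<mu>_def c_def flip: exp_of_nat_mult)
  also have "\<dots> \<le> real (card A) ^ m * exp (\<mu> * (lam + lam\<^sup>2))"
    using exp_le_quadratic[OF lam] by (intro mult_left_mono) (auto simp: \<mu>_def intro!: mult_left_mono divide_right_mono)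
  finally have "exp (- lam * \<mu>) * (\<Sum>y\<in>{..<m} \<rightarrow>\<^sub>E A. exp (lam * real (card {t \<in> {..<m}. u (y t) = \<alpha>})))
      \<le> exp (- lam * \<mu>) * (real (card A) ^ m * exp (\<mu> * (lam + lam\<^sup>2)))"
    by (intro mult_left_mono) auto
  moreover have "exp (lam * (x - \<mu>)) = exp (- lam * \<mu>) * exp (lam * x)" for x
    by (simp add: algebra_simps flip: exp_add)
  moreover have "exp (- lam * \<mu>) * (real (card A) ^ m * exp (\<mu> * (lam + lam\<^sup>2))) =
      real (card A) ^ m * (exp (- lam * \<mu>) * exp (\<mu> * (lam + lam\<^sup>2)))" by (simp only: mult_ac)
  moreover have "exp (- lam * \<mu>) * exp (\<mu> * (lam + lam\<^sup>2)) = exp (lam\<^sup>2 * \<mu>)"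
    by (simp add: algebra_simps flip: exp_add)
  ultimately show ?thesis by (simp only: sum_distrib_left)
qed

lemma exp_mult_abs_le: "exp (l * \<bar>x\<bar>) \<le> exp (l * x) + exp (- l * x)" for l x :: real
  by (cases "0 \<le> x") auto

text \<open>A deviation of the plurality is always caused by a deviation of some single count. A
  union bound over the values taken on \<open>A\<close> costs the factor \<open>card A\<close>, and
  the two signs of the deviation cost \<open>2\<close>.\<close>

lemma sum_exp_plurality_deviation_le:
  fixes u :: "'x \<Rightarrow> 'b" and m :: nat
  assumes A: "finite A" "A \<noteq> {}" and lam: "0 \<le> lam" "lam \<le> 1" and m: "0 < m"
  defines "\<mu> \<equiv> real m * real (plurality A u) / real (card A)"
  shows "(\<Sum>y\<in>{..<m} \<rightarrow>\<^sub>E A. exp (lam * \<bar>real (plurality {..<m} (u \<circ> y)) - \<mu>\<bar>))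
    \<le> 2 * real (card A) * (real (card A) ^ m * exp (lam\<^sup>2 * \<mu>))"
proof -
  define cnt where "cnt \<alpha> y = real (card {t \<in> {..<m}. u (y t) = \<alpha>})" for \<alpha> y
  define mean where "mean \<alpha> = real m * real (card {x \<in> A. u x = \<alpha>}) / real (card A)" for \<alpha>
  have cA: "real (card A) > 0" using A by (simp add: card_gt_0_iff)
  have mean_le: "mean \<alpha> \<le> \<mu>" for \<alpha>
    unfolding mean_def \<mu>_def using count_le_plurality[OF A(1), of u \<alpha>]
    by (intro divide_right_mono mult_left_mono) auto
  have dominated: "exp (lam * \<bar>real (plurality {..<m} (u \<circ> y)) - \<mu>\<bar>) \<le>
      (\<Sum>\<alpha>\<in>u ` A. exp (lam * (cnt \<alpha> y - mean \<alpha>)) + exp (- lam * (cnt \<alpha> y - mean \<alpha>)))"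
    if y: "y \<in> {..<m} \<rightarrow>\<^sub>E A" for y
  proof -
    \<comment> \<open>If the sample plurality is too large, take the value attaining it, whose mean
      is at most \<open>\<mu>\<close>. If it is too small, take the most frequent value in
      \<open>A\<close>, whose mean is \<open>\<mu>\<close> and whose count is at most the sample
      plurality.\<close>
    have "\<exists>\<alpha>\<in>u ` A. \<bar>real (plurality {..<m} (u \<circ> y)) - \<mu>\<bar> \<le> \<bar>cnt \<alpha> y - mean \<alpha>\<bar>"
    proof (cases "real (plurality {..<m} (u \<circ> y)) \<ge> \<mu>")
      case True
      obtain \<alpha> where "\<alpha> \<in> (u \<circ> y) ` {..<m}"
        and "card {t \<in> {..<m}. (u \<circ> y) t = \<alpha>} = plurality {..<m} (u \<circ> y)"
        using plurality_attained[of "{..<m}" "u \<circ> y"] m by auto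
      then have "\<alpha> \<in> u ` A" "cnt \<alpha> y = real (plurality {..<m} (u \<circ> y))"
        using y by (auto simp: cnt_def)
      with True mean_le[of \<alpha>] show ?thesis by (intro bexI[of _ \<alpha>]) auto
    next
      case False
      obtain \<alpha> where "\<alpha> \<in> u ` A" and "card {x \<in> A. u x = \<alpha>} = plurality A u"
        using plurality_attained[OF A, of u] by auto
      moreover from this have "mean \<alpha> = \<mu>" by (simp add: mean_def \<mu>_def)
      moreover have "cnt \<alpha> y \<le> real (plurality {..<m} (u \<circ> y))"
        using count_le_plurality[of "{..<m}" "u \<circ> y" \<alpha>] by (simp add: cnt_def)
      ultimately show ?thesis using False by (intro bexI[of _ \<alpha>]) auto
    qed
    then obtain \<alpha> where \<alpha>: "\<alpha> \<in> u ` A" "\<bar>real (plurality {..<m} (u \<circ> y)) - \<mu>\<bar> \<le> \<bar>cnt \<alpha> y - mean \<alpha>\<bar>"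
      by auto
    have "exp (lam * \<bar>real (plurality {..<m} (u \<circ> y)) - \<mu>\<bar>) \<le> exp (lam * \<bar>cnt \<alpha> y - mean \<alpha>\<bar>)"
      using \<alpha> lam by (simp add: mult_left_mono)
    also have "\<dots> \<le> exp (lam * (cnt \<alpha> y - mean \<alpha>)) + exp (- lam * (cnt \<alpha> y - mean \<alpha>))"
      by (rule exp_mult_abs_le)
    also have "\<dots> \<le> (\<Sum>\<alpha>\<in>u ` A. exp (lam * (cnt \<alpha> y - mean \<alpha>)) + exp (- lam * (cnt \<alpha> y - mean \<alpha>)))"
      using A \<alpha>(1) by (intro member_le_sum) (auto intro: add_nonneg_nonneg)
    finally show ?thesis .
  qed
  have each: "(\<Sum>y\<in>{..<m} \<rightarrow>\<^sub>E A. exp (lam * (cnt \<alpha> y - mean \<alpha>)) + exp (- lam * (cnt \<alpha> y - mean \<alpha>)))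
      \<le> 2 * (real (card A) ^ m * exp (lam\<^sup>2 * \<mu>))" for \<alpha>
  proof -
    have "(\<Sum>y\<in>{..<m} \<rightarrow>\<^sub>E A. exp (l * (cnt \<alpha> y - mean \<alpha>))) \<le> real (card A) ^ m * exp (lam\<^sup>2 * \<mu>)"
      if "\<bar>l\<bar> = lam" for l
    proof -
      have "(\<Sum>y\<in>{..<m} \<rightarrow>\<^sub>E A. exp (l * (cnt \<alpha> y - mean \<alpha>))) \<le> real (card A) ^ m * exp (l\<^sup>2 * mean \<alpha>)"
        unfolding cnt_def mean_def using that lam A by (intro sum_exp_count_deviation_le) auto
      also have "l\<^sup>2 = lam\<^sup>2" using that by (metis power2_abs)
      also have "real (card A) ^ m * exp (lam\<^sup>2 * mean \<alpha>) \<le> real (card A) ^ m * exp (lam\<^sup>2 * \<mu>)"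
        using mean_le by (intro mult_left_mono) (auto intro: mult_left_mono)
      finally show ?thesis .
    qed
    from this[of lam] this[of "- lam"] lam show ?thesis by (simp add: sum.distrib)
  qed
  have "(\<Sum>y\<in>{..<m} \<rightarrow>\<^sub>E A. exp (lam * \<bar>real (plurality {..<m} (u \<circ> y)) - \<mu>\<bar>)) \<le>
    (\<Sum>y\<in>{..<m} \<rightarrow>\<^sub>E A. \<Sum>\<alpha>\<in>u ` A. exp (lam * (cnt \<alpha> y - mean \<alpha>)) + exp (- lam * (cnt \<alpha> y - mean \<alpha>)))"
    by (intro sum_mono dominated)
  also have "\<dots> = (\<Sum>\<alpha>\<in>u ` A. \<Sum>y\<in>{..<m} \<rightarrow>\<^sub>E A.
      exp (lam * (cnt \<alpha> y - mean \<alpha>)) + exp (- lam * (cnt \<alpha> y - mean \<alpha>)))"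
    by (rule sum.swap)
  also have "\<dots> \<le> (\<Sum>\<alpha>\<in>u ` A. 2 * (real (card A) ^ m * exp (lam\<^sup>2 * \<mu>)))"
    by (intro sum_mono each)
  also have "\<dots> = real (card (u ` A)) * (2 * (real (card A) ^ m * exp (lam\<^sup>2 * \<mu>)))" by simp
  also have "\<dots> \<le> real (card A) * (2 * (real (card A) ^ m * exp (lam\<^sup>2 * \<mu>)))"
    using card_image_le[OF A(1), of u] by (intro mult_right_mono) auto
  finally show ?thesis by (simp add: mult_ac)
qed

lemma square_le_exp:
  fixes x :: real
  assumes "0 \<le> x"
  shows "x\<^sup>2 \<le> 2 * exp x"
  using exp_lower_Taylor_quadratic[OF assms] assms by (simp add: field_simps)

text \<open>The truncation is what allows an error linear in the plurality: a nonempty sample has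
  plurality at least \<open>1\<close>, which rescales to \<open>w\<close> even where
  \<open>plurality A u = 1\<close>, and \<open>w\<^sup>2\<close> can be much larger than
  \<open>w * s\<close>.\<close>

lemma sum_square_truncated_plurality_le:
  fixes u :: "'x \<Rightarrow> 'b" and m :: nat and s :: real
  assumes A: "finite A" "2 \<le> card A" and m: "0 < m" "m \<le> card A" and s: "6 * ln (real (card A)) \<le> s" "1 \<le> s"
  defines "w \<equiv> real (card A) / real m"
  shows "(\<Sum>y\<in>{..<m} \<rightarrow>\<^sub>E A. (w * max (real (plurality {..<m} (u \<circ> y)) - s) 0 - max (real (plurality A u) - w * s) 0)\<^sup>2)
    \<le> real (card A) ^ m * (40 * w * s * real (plurality A u))"
proof -
  define l where "l = real (card A)"
  define M where "M = real (plurality A u)"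
  define \<mu> where "\<mu> = real m * M / l"
  define d where "d y = real (plurality {..<m} (u \<circ> y)) - \<mu>" for y
  have l: "l \<ge> 2" using A by (simp add: l_def)
  have ne: "A \<noteq> {}" using A by auto
  have w: "1 \<le> w" "w \<le> l" using m l by (auto simp: w_def l_def field_simps)
  have wmu: "w * \<mu> = M" using m l by (simp add: w_def \<mu>_def flip: l_def)
  have M: "1 \<le> M" using plurality_ge_1[OF A(1) ne, of u] by (simp add: M_def)
  then have mu: "0 < \<mu>" using m l by (simp add: \<mu>_def)
  have key: "(\<Sum>y\<in>{..<m} \<rightarrow>\<^sub>E A. exp (lam * \<bar>d y\<bar>)) \<le> 2 * l * (l ^ m * exp (lam\<^sup>2 * \<mu>))"
    if "0 \<le> lam" "lam \<le> 1" for lam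
    unfolding d_def \<mu>_def M_def l_def using A ne m that by (intro sum_exp_plurality_deviation_le) auto
  \<comment> \<open>Explains the \<open>6\<close> in the lower bound on \<open>s\<close>: the
    estimate \<open>w \<le> l\<close>, squared, and the union bound cost three powers of
    \<open>l\<close>, which \<open>exp (- (s / 2))\<close> must absorb.\<close>
  have exp_s: "l ^ 3 * exp (- (s / 2)) \<le> 1"
  proof -
    have "exp (real 3 * ln l) = l ^ 3" unfolding exp_of_nat_mult using l by simp
    then have "l ^ 3 * exp (- (s / 2)) = exp (real 3 * ln l - s / 2)"
      by (simp only: exp_diff exp_minus divide_inverse)
    moreover have "real 3 * ln l - s / 2 \<le> 0" using s by (simp add: l_def)
    ultimately show ?thesis by (simp only: exp_le_one_iff)
  qed
  \<comment> \<open>If the expected count \<open>\<mu>\<close> is well below \<open>s\<close>, the truncated plurality of \<open>A\<close> vanishes and that of a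
    sample is rarely nonzero. Otherwise the truncation is dropped and \<open>lam\<close> is tuned so that
    deviations up to \<open>s / lam = 2 * sqrt (s * \<mu>)\<close> dominate.\<close>
  have "(\<Sum>y\<in>{..<m} \<rightarrow>\<^sub>E A. (w * max (real (plurality {..<m} (u \<circ> y)) - s) 0 - max (M - w * s) 0)\<^sup>2)
    \<le> l ^ m * (40 * w * s * M)"
  proof (cases "\<mu> \<le> s / 4")
    case True
    have "M \<le> w * (s / 4)" using mult_left_mono[OF True, of w] w wmu by simp
    moreover have "w * (s / 4) \<le> w * s" using w s by (intro mult_left_mono) auto
    ultimately have "M \<le> w * s" by linarith
    then have B: "max (M - w * s) 0 = 0" by simp
    \<comment> \<open>A plurality above \<open>s\<close> means a deviation above
      \<open>3 * s / 4\<close>. The square of the excess is traded for an exponential, whose average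
      is controlled by \<open>key\<close> with \<open>lam = 1\<close>.\<close>
    have term_le: "(w * max (real (plurality {..<m} (u \<circ> y)) - s) 0)\<^sup>2 \<le> l\<^sup>2 * (2 * exp (- (3 * s / 4)) * exp (1 * \<bar>d y\<bar>))"
      (is "?l \<le> ?r") for y
    proof (cases "real (plurality {..<m} (u \<circ> y)) \<le> s")
      case False
      have "0 \<le> real (plurality {..<m} (u \<circ> y)) - s" using False by simp
      moreover have "real (plurality {..<m} (u \<circ> y)) - s \<le> \<bar>d y\<bar> - 3 * s / 4"
        using True unfolding d_def by linarith
      ultimately have "(real (plurality {..<m} (u \<circ> y)) - s)\<^sup>2 \<le> (\<bar>d y\<bar> - 3 * s / 4)\<^sup>2"
        and "0 \<le> \<bar>d y\<bar> - 3 * s / 4"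
        by (auto intro!: power_mono)
      then have "(real (plurality {..<m} (u \<circ> y)) - s)\<^sup>2 \<le> 2 * exp (\<bar>d y\<bar> - 3 * s / 4)"
        using square_le_exp order_trans by blast
      also have "\<dots> = 2 * exp (- (3 * s / 4)) * exp (1 * \<bar>d y\<bar>)"
        by (simp add: mult.assoc flip: exp_add)
      finally have "w\<^sup>2 * (real (plurality {..<m} (u \<circ> y)) - s)\<^sup>2 \<le> ?r"
        using w by (intro mult_mono power_mono) auto
      then show ?thesis using False by (simp add: power_mult_distrib)
    qed auto
    have "(\<Sum>y\<in>{..<m} \<rightarrow>\<^sub>E A. (w * max (real (plurality {..<m} (u \<circ> y)) - s) 0 - max (M - w * s) 0)\<^sup>2) \<le>
        (\<Sum>y\<in>{..<m} \<rightarrow>\<^sub>E A. l\<^sup>2 * (2 * exp (- (3 * s / 4)) * exp (1 * \<bar>d y\<bar>)))"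
      unfolding B using term_le by (intro sum_mono) simp
    also have "\<dots> = l\<^sup>2 * (2 * exp (- (3 * s / 4)) * (\<Sum>y\<in>{..<m} \<rightarrow>\<^sub>E A. exp (1 * \<bar>d y\<bar>)))"
      by (simp add: sum_distrib_left)
    also have "\<dots> \<le> l\<^sup>2 * (2 * exp (- (3 * s / 4)) * (2 * l * (l ^ m * exp (1\<^sup>2 * \<mu>))))"
      by (intro mult_left_mono key) auto
    also have "\<dots> \<le> l\<^sup>2 * (2 * exp (- (3 * s / 4)) * (2 * l * (l ^ m * exp (s / 4))))"
      using True l by (intro mult_left_mono) auto
    also have "\<dots> = 4 * l ^ m * (l ^ 3 * (exp (- (3 * s / 4)) * exp (s / 4)))"
      by (simp add: power2_eq_square power3_eq_cube)
    also have "exp (- (3 * s / 4)) * exp (s / 4) = exp (- (s / 2))" by (simp flip: exp_add)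
    also have "4 * l ^ m * (l ^ 3 * exp (- (s / 2))) \<le> 4 * l ^ m * 1"
      using l exp_s by (intro mult_left_mono) auto
    also have "\<dots> \<le> l ^ m * (40 * w * s * M)"
    proof -
      have "1 * 1 * 1 \<le> w * s * M" using w s M by (intro mult_mono) auto
      then have "4 \<le> 40 * w * s * M" by linarith
      then have "l ^ m * 4 \<le> l ^ m * (40 * w * s * M)" using l by (intro mult_left_mono) auto
      then show ?thesis by simp
    qed
    finally show ?thesis .
  next
    case False
    define lam where "lam = sqrt (s / (4 * \<mu>))"
    have lam: "0 < lam" "lam \<le> 1" using False s mu by (auto simp: lam_def)
    have lam2: "lam\<^sup>2 = s / (4 * \<mu>)" using s mu by (simp add: lam_def)
    have term_le: "(w * max (real (plurality {..<m} (u \<circ> y)) - s) 0 - max (M - w * s) 0)\<^sup>2 \<le>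
       w\<^sup>2 * (8 * s * \<mu> + 16 * \<mu> * exp (- s) * exp (lam * \<bar>d y\<bar>))" (is "?l \<le> ?r") for y
    proof -
      have "w * max (real (plurality {..<m} (u \<circ> y)) - s) 0 - max (M - w * s) 0
          = w * (max (real (plurality {..<m} (u \<circ> y)) - s) 0 - max (\<mu> - s) 0)"
        using w max_mult_distrib_left[of w "\<mu> - s" 0] by (simp add: right_diff_distrib wmu)
      then have "?l = w\<^sup>2 * \<bar>max (real (plurality {..<m} (u \<circ> y)) - s) 0 - max (\<mu> - s) 0\<bar>\<^sup>2"
        by (simp add: power_mult_distrib)
      \<comment> \<open>Truncation is 1-Lipschitz.\<close>
      also have "\<dots> \<le> w\<^sup>2 * \<bar>d y\<bar>\<^sup>2"
        by (intro mult_left_mono power_mono) (auto simp: d_def)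
      also have "\<bar>d y\<bar>\<^sup>2 \<le> 8 * s * \<mu> + 16 * \<mu> * exp (- s) * exp (lam * \<bar>d y\<bar>)"
      proof (cases "lam * \<bar>d y\<bar> \<le> s")
        case True
        have "(lam * \<bar>d y\<bar>)\<^sup>2 \<le> s\<^sup>2" using True lam by (intro power_mono) auto
        then have "s / (4 * \<mu>) * \<bar>d y\<bar>\<^sup>2 \<le> s\<^sup>2" by (simp only: power_mult_distrib lam2)
        then have "(4 * \<mu> / s) * (s / (4 * \<mu>) * \<bar>d y\<bar>\<^sup>2) \<le> (4 * \<mu> / s) * s\<^sup>2"
          using mu s by (intro mult_left_mono) auto
        then have "\<bar>d y\<bar>\<^sup>2 \<le> 4 * s * \<mu>"
          using mu s by (simp add: power2_eq_square mult_ac)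
        moreover have "0 \<le> s * \<mu>" "0 \<le> 16 * \<mu> * exp (- s) * exp (lam * \<bar>d y\<bar>)" using mu s by auto
        ultimately show ?thesis by linarith
      next
        case False
        \<comment> \<open>Only the excess over \<open>s\<close> is traded for an exponential; this
          leaves a factor \<open>exp (- s)\<close> to beat the union bound.\<close>
        have "(lam * \<bar>d y\<bar>)\<^sup>2 = (s + (lam * \<bar>d y\<bar> - s))\<^sup>2" by simp
        also have "\<dots> \<le> 2 * s\<^sup>2 + 2 * (lam * \<bar>d y\<bar> - s)\<^sup>2"
          using sum_squares_bound[of s "lam * \<bar>d y\<bar> - s"] by (simp only: power2_sum)
        also have "(lam * \<bar>d y\<bar> - s)\<^sup>2 \<le> 2 * exp (lam * \<bar>d y\<bar> - s)"
          using False by (intro square_le_exp) auto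
        also have "exp (lam * \<bar>d y\<bar> - s) = exp (- s) * exp (lam * \<bar>d y\<bar>)"
          by (simp flip: exp_add)
        finally have "s / (4 * \<mu>) * \<bar>d y\<bar>\<^sup>2 \<le> 2 * s\<^sup>2 + 4 * (exp (- s) * exp (lam * \<bar>d y\<bar>))"
          using lam2 by (simp add: power_mult_distrib)
        then have "(4 * \<mu> / s) * (s / (4 * \<mu>) * \<bar>d y\<bar>\<^sup>2) \<le> (4 * \<mu> / s) * (2 * s\<^sup>2 + 4 * (exp (- s) * exp (lam * \<bar>d y\<bar>)))"
          using mu s by (intro mult_left_mono) auto
        then have "\<bar>d y\<bar>\<^sup>2 \<le> 8 * s * \<mu> + (16 * \<mu> * exp (- s) * exp (lam * \<bar>d y\<bar>)) / s"
          using mu s by (simp add: field_simps power2_eq_square)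
        also have "(16 * \<mu> * exp (- s) * exp (lam * \<bar>d y\<bar>)) / s \<le> (16 * \<mu> * exp (- s) * exp (lam * \<bar>d y\<bar>)) / 1"
          using mu s by (intro divide_left_mono) auto
        finally show ?thesis by simp
      qed
      finally show ?thesis by (simp add: mult_left_mono)
    qed
    have "(\<Sum>y\<in>{..<m} \<rightarrow>\<^sub>E A. (w * max (real (plurality {..<m} (u \<circ> y)) - s) 0 - max (M - w * s) 0)\<^sup>2) \<le>
        (\<Sum>y\<in>{..<m} \<rightarrow>\<^sub>E A. w\<^sup>2 * (8 * s * \<mu> + 16 * \<mu> * exp (- s) * exp (lam * \<bar>d y\<bar>)))"
      by (intro sum_mono term_le)
    also have "\<dots> = w\<^sup>2 * (l ^ m * (8 * s * \<mu>) + 16 * \<mu> * exp (- s) * (\<Sum>y\<in>{..<m} \<rightarrow>\<^sub>E A. exp (lam * \<bar>d y\<bar>)))"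
      by (simp add: sum_distrib_left[symmetric] sum.distrib card_funcsetE l_def)
    also have "\<dots> \<le> w\<^sup>2 * (l ^ m * (8 * s * \<mu>) + 16 * \<mu> * exp (- s) * (2 * l * (l ^ m * exp (lam\<^sup>2 * \<mu>))))"
      using lam mu by (intro mult_left_mono add_left_mono key) auto
    also have "lam\<^sup>2 * \<mu> = s / 4" using lam2 mu by simp
    also have "w\<^sup>2 * (l ^ m * (8 * s * \<mu>) + 16 * \<mu> * exp (- s) * (2 * l * (l ^ m * exp (s / 4)))) =
        w\<^sup>2 * l ^ m * \<mu> * (8 * s + 32 * (l * (exp (- s) * exp (s / 4))))"
      by (simp add: algebra_simps)
    also have "\<dots> \<le> w\<^sup>2 * l ^ m * \<mu> * (8 * s + 32 * 1)"
    proof (intro mult_left_mono add_left_mono)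
      have "l * (exp (- s) * exp (s / 4)) = l * exp (- (3 * s / 4))" by (simp flip: exp_add)
      also have "\<dots> \<le> l ^ 3 * exp (- (s / 2))"
        using l s power_increasing[of 1 3 l] by (intro mult_mono) auto
      finally show "l * (exp (- s) * exp (s / 4)) \<le> 1" using exp_s by simp
    qed (use l mu in auto)
    \<comment> \<open>By \<open>1 \<le> s\<close>, \<open>8 * s + 32 \<le> 40 * s\<close>: the
      source of the constant \<open>40\<close>.\<close>
    also have "\<dots> \<le> w\<^sup>2 * l ^ m * \<mu> * (40 * s)"
      using l mu s by (intro mult_left_mono) auto
    also have "\<dots> = l ^ m * (40 * w * s * (w * \<mu>))" by (simp add: power2_eq_square)
    finally show ?thesis by (simp only: wmu)
  qed
  then show ?thesis by (simp only: M_def l_def)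
qed

text \<open>First moment method: the error summed over \<open>J\<close> meets the bound on average
  over all samples, so some sample meets it. One sample serves all coordinates together, so a level
  of the chain can be indexed by samples alone.\<close>

lemma obtain_sample:
  fixes h :: "'j \<Rightarrow> 'x \<Rightarrow> 'b" and m :: nat and s :: real
  assumes J: "finite J" and A: "finite A" "2 \<le> card A" and m: "0 < m" "m \<le> card A"
    and s: "6 * ln (real (card A)) \<le> s" "1 \<le> s"
  defines "w \<equiv> real (card A) / real m"
  obtains y where "y \<in> {..<m} \<rightarrow>\<^sub>E A"
    "(\<Sum>j\<in>J. (w * max (real (plurality {..<m} (h j \<circ> y)) - s) 0 - max (real (plurality A (h j)) - w * s) 0)\<^sup>2)
      \<le> 40 * w * s * (\<Sum>j\<in>J. real (plurality A (h j)))"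
proof -
  define err where "err y j = (w * max (real (plurality {..<m} (h j \<circ> y)) - s) 0 -
    max (real (plurality A (h j)) - w * s) 0)\<^sup>2" for y j
  define R where "R = 40 * w * s * (\<Sum>j\<in>J. real (plurality A (h j)))"
  have fin: "finite ({..<m} \<rightarrow>\<^sub>E A)" using A by (intro finite_PiE) auto
  have ne: "{..<m} \<rightarrow>\<^sub>E A \<noteq> {}" using A by (auto simp: PiE_eq_empty_iff)
  have "(\<Sum>y\<in>{..<m} \<rightarrow>\<^sub>E A. \<Sum>j\<in>J. err y j) = (\<Sum>j\<in>J. \<Sum>y\<in>{..<m} \<rightarrow>\<^sub>E A. err y j)"
    by (rule sum.swap)
  also have "\<dots> \<le> (\<Sum>j\<in>J. real (card A) ^ m * (40 * w * s * real (plurality A (h j))))"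
    unfolding err_def w_def by (intro sum_mono sum_square_truncated_plurality_le assms)
  also have "\<dots> = (\<Sum>y\<in>{..<m} \<rightarrow>\<^sub>E A. R)"
    by (simp add: sum_distrib_left R_def card_funcsetE)
  finally have "(\<Sum>y\<in>{..<m} \<rightarrow>\<^sub>E A. \<Sum>j\<in>J. err y j) \<le> (\<Sum>y\<in>{..<m} \<rightarrow>\<^sub>E A. R)" .
  then have "\<exists>y\<in>{..<m} \<rightarrow>\<^sub>E A. (\<Sum>j\<in>J. err y j) \<le> R"
    using sum_strict_mono[OF fin ne, of "\<lambda>_. R" "\<lambda>y. \<Sum>j\<in>J. err y j"] by fastforce
  then show thesis using that unfolding err_def R_def by blast
qed

subsection \<open>Chaining\<close>

lemma square_sum3_le: "(x + y + z)\<^sup>2 \<le> 3 * (x\<^sup>2 + y\<^sup>2 + z\<^sup>2)" for x y z :: real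
proof -
  have "0 \<le> (x - y)\<^sup>2 + (y - z)\<^sup>2 + (x - z)\<^sup>2" by simp
  then show ?thesis by (simp add: power2_eq_square algebra_simps)
qed

text \<open>The process telescopes from exact pluralities at level \<open>0\<close> down to
  \<open>0\<close> at level \<open>I\<close>, and the finite class bound is applied to each
  increment. There are at most \<open>log 2 L\<close> levels; moved under the root, their number
  yields two of the three logarithms, and \<open>s\<close> yields the third.\<close>

lemma rademacher_max_plurality_le:
  fixes h :: "'j \<Rightarrow> 'x \<Rightarrow> 'b" and Q :: real
  assumes J: "finite J" "J \<noteq> {}" and X: "finite X" and L: "2 \<le> L" "L \<le> card X"
  defines "T \<equiv> {\<Lambda>. \<Lambda> \<subseteq> X \<and> card \<Lambda> = L}"
  assumes Q: "\<And>\<Lambda>. \<Lambda> \<in> T \<Longrightarrow> (\<Sum>j\<in>J. real (plurality \<Lambda> (h j))) \<le> Q"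
  shows "rademacher_max J T (\<lambda>\<Lambda> j. real (plurality \<Lambda> (h j)))
    \<le> sqrt (12000 * real L * ln (real (card X)) * log 2 (real L) ^ 3 * Q)"
proof -
  define s where "s = 6 * log 2 (real L)"
  have log_ge: "1 \<le> log 2 (real L)" using L by (simp add: le_log_iff)
  have s: "6 * ln (real L) \<le> s" "6 \<le> s"
  proof -
    have "ln (real L) * ln 2 \<le> ln (real L) * 1" using L ln_2_less_1 by (intro mult_left_mono) auto
    then show "6 * ln (real L) \<le> s" unfolding s_def log_def by (simp add: field_simps)
  qed (use log_ge in \<open>simp add: s_def\<close>)

  \<comment> \<open>Levels of the chain\<close>
  obtain I where I: "2 ^ I \<le> L" "L < 2 ^ (I + 1)"
    using ex_power_ivl1[of 2 L] L by auto
  have I1: "1 \<le> I" using I L by (cases I) auto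
  have Ilog: "real I \<le> log 2 (real L)" using I L by (intro le_log2_of_power) auto
  define m where "m i = L div 2 ^ i" for i
  define w where "w i = real L / real (m i)" for i
  \<comment> \<open>No truncation at level \<open>0\<close>, where the sample enumerates \<open>\<Lambda>\<close> and \<open>W\<close> is the exact plurality;
    at level \<open>I\<close> a sample has one element, and \<open>1 \<le> s\<close> gives \<open>W = 0\<close>.\<close>
  define thr where "thr i = (if i = 0 then 0 else s)" for i :: nat
  define W where "W i y j = w i * max (real (plurality {..<m i} (h j \<circ> y)) - thr i) 0" for i y j
  define B where "B i \<Lambda> j = max (real (plurality \<Lambda> (h j)) - w i * thr i) 0" for i \<Lambda> j
  have m: "0 < m i" "m i \<le> L" if "i \<le> I" for i
  proof -
    have "2 ^ i \<le> (2 ^ I :: nat)" using that by (intro power_increasing) auto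
    then have "2 ^ i \<le> L" using I(1) by (rule order_trans)
    then show "0 < m i" by (simp add: m_def div_greater_zero_iff)
  qed (simp add: m_def)
  have mI: "m I = 1" using I by (simp add: m_def div_nat_eqI)
  \<comment> \<open>Halving rounds down, as in \<open>3 div 2 = 1\<close>, so consecutive sizes may
    differ by a factor up to \<open>3\<close>.\<close>
  have m_Suc: "m (Suc i) \<le> m i" "m i \<le> 3 * m (Suc i)" if "Suc i \<le> I" for i
  proof -
    have "m (Suc i) = m i div 2" by (simp only: m_def power_Suc2 div_mult2_eq)
    with m(1)[OF that] show "m (Suc i) \<le> m i" "m i \<le> 3 * m (Suc i)" by linarith+
  qed
  have w: "1 \<le> w i" "w i * real (m i) = real L" if "i \<le> I" for i
    using m[OF that] by (auto simp: w_def)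
  have w_Suc: "w i \<le> w (Suc i)" "w (Suc i) \<le> 3 * w i" if "Suc i \<le> I" for i
  proof -
    have "0 < real (m i)" "0 < real (m (Suc i))" using m that by auto
    moreover have "real (m (Suc i)) \<le> real (m i)" "real (m i) \<le> 3 * real (m (Suc i))"
      using m_Suc[OF that] by linarith+
    ultimately show "w i \<le> w (Suc i)" "w (Suc i) \<le> 3 * w i"
      unfolding w_def by (auto simp: field_simps intro!: mult_left_mono)
  qed
  have T: "finite T" "T \<noteq> {}"
  proof -
    show "finite T" unfolding T_def using X by (auto intro: finite_subset[of _ "Pow X"])
    show "T \<noteq> {}" using obtain_subset_with_card_n[OF L(2)] unfolding T_def by blast
  qed
  have TD: "finite \<Lambda>" "card \<Lambda> = L" "\<Lambda> \<subseteq> X" "\<Lambda> \<noteq> {}" if "\<Lambda> \<in> T" for \<Lambda>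
    using that X L finite_subset unfolding T_def by auto
  \<comment> \<open>Makes the variance bounds \<open>V i\<close> positive, as the finite class bound
    demands.\<close>
  have Q1: "1 \<le> Q"
  proof -
    obtain \<Lambda> where \<Lambda>: "\<Lambda> \<in> T" using T by auto
    obtain j where j: "j \<in> J" using J by auto
    have "1 \<le> real (plurality \<Lambda> (h j))" using plurality_ge_1[of \<Lambda> "h j"] TD[OF \<Lambda>] by simp
    also have "\<dots> \<le> (\<Sum>j\<in>J. real (plurality \<Lambda> (h j)))" using j J by (intro member_le_sum) auto
    finally show ?thesis using Q[OF \<Lambda>] by linarith
  qed

  \<comment> \<open>A good sample for every level and message set\<close>
  have ex_sample: "\<exists>y\<in>{..<m i} \<rightarrow>\<^sub>E X. (i = 0 \<longrightarrow> (\<forall>j. W i y j = real (plurality \<Lambda> (h j)))) \<and>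
      (\<Sum>j\<in>J. (W i y j - B i \<Lambda> j)\<^sup>2) \<le> 40 * w i * s * Q" if \<Lambda>: "\<Lambda> \<in> T" and i: "i \<le> I" for \<Lambda> i
  proof (cases "i = 0")
    case True
    obtain b where b: "bij_betw b {..<L} \<Lambda>"
      using ex_bij_betw_nat_finite[of \<Lambda>] TD[OF \<Lambda>] by (auto simp: atLeast0LessThan)
    define y where "y = restrict b {..<L}"
    have y: "bij_betw y {..<L} \<Lambda>" using b bij_betw_cong[of "{..<L}" y b \<Lambda>] by (simp add: y_def)
    have mi: "m i = L" "w i = 1" "thr i = 0" using True L by (auto simp: m_def w_def thr_def)
    have "y \<in> {..<m i} \<rightarrow>\<^sub>E X"
      using y TD(3)[OF \<Lambda>] unfolding mi by (auto simp: y_def bij_betw_def)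
    moreover have W: "W i y j = real (plurality \<Lambda> (h j))" for j
      unfolding W_def mi plurality_bij[OF y] by simp
    moreover have "B i \<Lambda> j = real (plurality \<Lambda> (h j))" for j
      by (simp add: B_def mi)
    moreover have "0 \<le> 40 * w i * s * Q" using mi s Q1 by simp
    ultimately show ?thesis by (intro bexI[of _ y]) auto
  next
    case False
    have L': "L = card \<Lambda>" using TD[OF \<Lambda>] by simp
    obtain y where y: "y \<in> {..<m i} \<rightarrow>\<^sub>E \<Lambda>"
      "(\<Sum>j\<in>J. (w i * max (real (plurality {..<m i} (h j \<circ> y)) - s) 0 - max (real (plurality \<Lambda> (h j)) - w i * s) 0)\<^sup>2)
       \<le> 40 * w i * s * (\<Sum>j\<in>J. real (plurality \<Lambda> (h j)))"
      using obtain_sample[of J \<Lambda> "m i" s h] J TD[OF \<Lambda>] L m[OF i] s unfolding w_def L' by auto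
    have "(\<Sum>j\<in>J. (W i y j - B i \<Lambda> j)\<^sup>2) \<le> 40 * w i * s * (\<Sum>j\<in>J. real (plurality \<Lambda> (h j)))"
      using y(2) False by (simp add: W_def B_def thr_def)
    also have "\<dots> \<le> 40 * w i * s * Q"
      using Q[OF \<Lambda>] w[OF i] s by (intro mult_left_mono) auto
    finally have "(\<Sum>j\<in>J. (W i y j - B i \<Lambda> j)\<^sup>2) \<le> 40 * w i * s * Q" .
    moreover have "y \<in> {..<m i} \<rightarrow>\<^sub>E X" using y(1) TD(3)[OF \<Lambda>] by (auto simp: PiE_iff)
    ultimately show ?thesis using False by blast
  qed
  define good where "good i \<Lambda> y \<longleftrightarrow> y \<in> {..<m i} \<rightarrow>\<^sub>E X \<and>
      (i = 0 \<longrightarrow> (\<forall>j. W i y j = real (plurality \<Lambda> (h j)))) \<and>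
      (\<Sum>j\<in>J. (W i y j - B i \<Lambda> j)\<^sup>2) \<le> 40 * w i * s * Q" for i \<Lambda> y
  define Y where "Y i \<Lambda> = (SOME y. good i \<Lambda> y)" for i \<Lambda>
  have good_Y: "good i \<Lambda> (Y i \<Lambda>)" if "i \<le> I" "\<Lambda> \<in> T" for i \<Lambda>
  proof -
    have "\<exists>y. good i \<Lambda> y" using ex_sample[OF that(2,1)] unfolding good_def Bex_def .
    then show ?thesis unfolding Y_def by (rule someI_ex[of "good i \<Lambda>"])
  qed
  have Y: "Y i \<Lambda> \<in> {..<m i} \<rightarrow>\<^sub>E X" if "i \<le> I" "\<Lambda> \<in> T" for i \<Lambda>
    using good_Y[OF that] unfolding good_def by blast
  have Y0: "W 0 (Y 0 \<Lambda>) j = real (plurality \<Lambda> (h j))" if "\<Lambda> \<in> T" for \<Lambda> j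
    using good_Y[OF le0 that] unfolding good_def by blast
  have YB: "(\<Sum>j\<in>J. (W i (Y i \<Lambda>) j - B i \<Lambda> j)\<^sup>2) \<le> 40 * w i * s * Q" if "i \<le> I" "\<Lambda> \<in> T" for i \<Lambda>
    using good_Y[OF that] unfolding good_def by blast

  \<comment> \<open>Increments and nets\<close>
  define V where "V i = 500 * w i * s * Q" for i
  define D where "D i = (\<lambda>(y, y') j. W i y j - W (Suc i) y' j)" for i
  \<comment> \<open>All close pairs of samples are kept, whether or not they come from a common
    message set. The size of the net is then bounded by counting functions into \<open>X\<close>,
    with exponent governed by \<open>m i\<close> instead of \<open>L\<close>.\<close>
  define net where "net i = {t \<in> ({..<m i} \<rightarrow>\<^sub>E X) \<times> ({..<m (Suc i)} \<rightarrow>\<^sub>E X). (\<Sum>j\<in>J. (D i t j)\<^sup>2) \<le> V i}" for i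
  have increment: "(Y i \<Lambda>, Y (Suc i) \<Lambda>) \<in> net i" if i: "i < I" and \<Lambda>: "\<Lambda> \<in> T" for i \<Lambda>
  proof -
    \<comment> \<open>The difference is bounded both by the larger threshold and by the plurality;
      multiplying the two bounds keeps the square linear in the plurality.\<close>
    have B: "(B i \<Lambda> j - B (Suc i) \<Lambda> j)\<^sup>2 \<le> w (Suc i) * s * real (plurality \<Lambda> (h j))" for j
    proof -
      have "w i * thr i \<le> w (Suc i) * s" "0 \<le> w i * thr i"
        using w_Suc[of i] w[of i] w[of "Suc i"] i s by (auto simp: thr_def intro!: mult_mono)
      then have "0 \<le> B i \<Lambda> j - B (Suc i) \<Lambda> j" "B i \<Lambda> j - B (Suc i) \<Lambda> j \<le> w (Suc i) * s"
        "B i \<Lambda> j - B (Suc i) \<Lambda> j \<le> real (plurality \<Lambda> (h j))"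
        by (auto simp: B_def thr_def)
      then show ?thesis unfolding power2_eq_square by (intro mult_mono) auto
    qed
    have "(\<Sum>j\<in>J. (W i (Y i \<Lambda>) j - W (Suc i) (Y (Suc i) \<Lambda>) j)\<^sup>2) \<le>
      (\<Sum>j\<in>J. 3 * ((W i (Y i \<Lambda>) j - B i \<Lambda> j)\<^sup>2 + w (Suc i) * s * real (plurality \<Lambda> (h j)) +
        (W (Suc i) (Y (Suc i) \<Lambda>) j - B (Suc i) \<Lambda> j)\<^sup>2))"
    proof (rule sum_mono)
      fix j
      have "(W i (Y i \<Lambda>) j - W (Suc i) (Y (Suc i) \<Lambda>) j)\<^sup>2 =
          ((W i (Y i \<Lambda>) j - B i \<Lambda> j) + (B i \<Lambda> j - B (Suc i) \<Lambda> j) + (B (Suc i) \<Lambda> j - W (Suc i) (Y (Suc i) \<Lambda>) j))\<^sup>2"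
        by simp
      also note square_sum3_le
      finally show "(W i (Y i \<Lambda>) j - W (Suc i) (Y (Suc i) \<Lambda>) j)\<^sup>2 \<le>
          3 * ((W i (Y i \<Lambda>) j - B i \<Lambda> j)\<^sup>2 + w (Suc i) * s * real (plurality \<Lambda> (h j)) +
          (W (Suc i) (Y (Suc i) \<Lambda>) j - B (Suc i) \<Lambda> j)\<^sup>2)"
        using B[of j] by (simp add: power2_commute[of "B (Suc i) \<Lambda> j"])
    qed
    also have "\<dots> = 3 * ((\<Sum>j\<in>J. (W i (Y i \<Lambda>) j - B i \<Lambda> j)\<^sup>2) +
        w (Suc i) * s * (\<Sum>j\<in>J. real (plurality \<Lambda> (h j))) +
        (\<Sum>j\<in>J. (W (Suc i) (Y (Suc i) \<Lambda>) j - B (Suc i) \<Lambda> j)\<^sup>2))"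
      by (simp add: sum.distrib sum_distrib_left)
    also have "\<dots> \<le> 3 * (40 * w i * s * Q + w (Suc i) * s * Q + 40 * w (Suc i) * s * Q)"
      using i \<Lambda> Q[OF \<Lambda>] w[of "Suc i"] s by (intro mult_left_mono add_mono YB) auto
    also have "\<dots> = (120 * w i + 123 * w (Suc i)) * (s * Q)" by (simp add: algebra_simps)
    \<comment> \<open>Weights grow by at most a factor \<open>3\<close>, and
      \<open>120 + 3 * 123 = 489\<close>.\<close>
    also have "\<dots> \<le> (500 * w i) * (s * Q)"
      using w_Suc[of i] w[of i] i s Q1 by (intro mult_right_mono) auto
    finally show ?thesis
      using Y[of i \<Lambda>] Y[of "Suc i" \<Lambda>] i \<Lambda> by (auto simp: net_def D_def V_def mult_ac)
  qed
  have fin_net: "finite (net i)" for i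
    unfolding net_def using X by (intro finite_subset[OF Collect_subset]) (auto intro!: finite_PiE)
  have net_ne: "net i \<noteq> {}" if "i < I" for i
    using increment[OF that] T by auto
  have WI: "W I y j = 0" for y j
    using plurality_le_card[of "{..<m I}" "h j \<circ> y"] I1 s mI by (simp add: W_def thr_def)
  \<comment> \<open>The samples \<open>Y i \<Lambda>\<close> do not depend on the signs, so for
    every sign pattern the same chain is available and each of its links lies in a fixed
    net.\<close>
  have pointwise: "(MAX \<Lambda>\<in>T. \<Sum>j\<in>J. sgn_of S j * real (plurality \<Lambda> (h j))) \<le>
      (\<Sum>i<I. MAX t\<in>net i. \<Sum>j\<in>J. sgn_of S j * D i t j)" for S
  proof (subst Max_le_iff; (intro ballI)?)
    fix v assume "v \<in> (\<lambda>\<Lambda>. \<Sum>j\<in>J. sgn_of S j * real (plurality \<Lambda> (h j))) ` T"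
    then obtain \<Lambda> where \<Lambda>: "\<Lambda> \<in> T" and v: "v = (\<Sum>j\<in>J. sgn_of S j * real (plurality \<Lambda> (h j)))" by auto
    have telescope: "real (plurality \<Lambda> (h j)) = (\<Sum>i<I. D i (Y i \<Lambda>, Y (Suc i) \<Lambda>) j)" for j
      using sum_lessThan_telescope'[of "\<lambda>i. W i (Y i \<Lambda>) j" I] WI Y0[OF \<Lambda>] by (simp add: D_def)
    have "v = (\<Sum>i<I. \<Sum>j\<in>J. sgn_of S j * D i (Y i \<Lambda>, Y (Suc i) \<Lambda>) j)"
      unfolding v telescope sum_distrib_left by (rule sum.swap)
    also have "\<dots> \<le> (\<Sum>i<I. MAX t\<in>net i. \<Sum>j\<in>J. sgn_of S j * D i t j)"
      using increment \<Lambda> fin_net by (intro sum_mono Max_ge) auto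
    finally show "v \<le> (\<Sum>i<I. MAX t\<in>net i. \<Sum>j\<in>J. sgn_of S j * D i t j)" .
  qed (use T in auto)

  \<comment> \<open>Summation over the levels\<close>
  have lnN: "0 < ln (real (card X))" using L by simp
  have "rademacher_max J T (\<lambda>\<Lambda> j. real (plurality \<Lambda> (h j))) \<le> (\<Sum>i<I. rademacher_max J (net i) (D i))"
  proof -
    have "(\<Sum>S\<in>Pow J. MAX \<Lambda>\<in>T. \<Sum>j\<in>J. sgn_of S j * real (plurality \<Lambda> (h j))) \<le>
        (\<Sum>S\<in>Pow J. \<Sum>i<I. MAX t\<in>net i. \<Sum>j\<in>J. sgn_of S j * D i t j)"
      by (intro sum_mono pointwise)
    also have "\<dots> = (\<Sum>i<I. \<Sum>S\<in>Pow J. MAX t\<in>net i. \<Sum>j\<in>J. sgn_of S j * D i t j)"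
      by (rule sum.swap)
    finally show ?thesis
      unfolding rademacher_max_def sum_divide_distrib[symmetric] by (intro divide_right_mono) auto
  qed
  also have "\<dots> \<le> (\<Sum>i<I. sqrt (2000 * real L * s * Q * ln (real (card X))))"
  proof (rule sum_mono)
    fix i assume "i \<in> {..<I}"
    then have i: "i < I" by simp
    define P where "P = real (card X) ^ (2 * m i)"
    have "card (net i) \<le> card (({..<m i} \<rightarrow>\<^sub>E X) \<times> ({..<m (Suc i)} \<rightarrow>\<^sub>E X))"
      unfolding net_def using X by (intro card_mono) (auto intro!: finite_PiE)
    also have "\<dots> = card X ^ (m i + m (Suc i))"
      by (simp add: card_cartesian_product card_funcsetE power_add)
    also have "\<dots> \<le> card X ^ (2 * m i)"
      using m_Suc(1)[of i] i L by (intro power_increasing) auto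
    finally have P: "real (card (net i)) \<le> P" unfolding P_def by (simp flip: of_nat_power)
    have "1 < P" unfolding P_def using m[of i] i L by (intro one_less_power) auto
    then have "rademacher_max J (net i) (D i) \<le> sqrt (2 * V i * ln P)"
      using J fin_net net_ne[OF i] P w[of i] i s Q1
      by (intro rademacher_max_le) (auto simp: net_def V_def)
    \<comment> \<open>Here \<open>2000 = 2 * 500 * 2\<close>, the last factor coming from the pair
      of samples in \<open>P\<close>. The product \<open>w i * m i\<close> makes the bound the same
      at every level.\<close>
    also have "2 * V i * ln P = 2000 * (w i * real (m i)) * s * Q * ln (real (card X))"
      using L by (simp add: P_def V_def ln_realpow mult_ac)
    also have "w i * real (m i) = real L" using w i by simp
    finally show "rademacher_max J (net i) (D i) \<le> sqrt (2000 * real L * s * Q * ln (real (card X)))" .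
  qed
  also have "\<dots> = real I * sqrt (2000 * real L * s * Q * ln (real (card X)))" by simp
  also have "\<dots> \<le> log 2 (real L) * sqrt (2000 * real L * s * Q * ln (real (card X)))"
    using Ilog s Q1 lnN by (intro mult_right_mono) auto
  also have "\<dots> = sqrt ((log 2 (real L))\<^sup>2 * (2000 * real L * s * Q * ln (real (card X))))"
    using log_ge by (simp add: real_sqrt_mult)
  also have "(log 2 (real L))\<^sup>2 * (2000 * real L * s * Q * ln (real (card X))) =
      12000 * real L * ln (real (card X)) * log 2 (real L) ^ 3 * Q"
    by (simp add: s_def power2_eq_square power3_eq_cube mult_ac)
  finally show ?thesis .
qed

subsection \<open>Symmetrization\<close>

text \<open>A quadratic inequality in \<open>r = sqrt Q\<close>:
  \<open>r * (r - y) \<le> e * e\<close> forces \<open>r \<le> y + e\<close>, and inserting this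
  into \<open>y * r\<close> once gives the claim.\<close>

lemma le_if_le_add_sqrt:
  fixes E Y Q :: real
  assumes "0 \<le> E" "0 \<le> Y" "0 \<le> Q" and Q: "Q \<le> E + sqrt (Y * Q)"
  shows "Q \<le> E + Y + sqrt (E * Y)"
proof -
  define e y r where "e = sqrt E" and "y = sqrt Y" and "r = sqrt Q"
  have nonneg: "0 \<le> e" "0 \<le> y" "0 \<le> r" using assms by (auto simp: e_def y_def r_def)
  have sq: "E = e * e" "Y = y * y" "Q = r * r" using assms by (auto simp: e_def y_def r_def)
  have bound: "r * r \<le> e * e + y * r"
    using Q by (simp add: real_sqrt_mult flip: y_def r_def sq)
  have "r \<le> y + e"
  proof (rule ccontr)
    assume "\<not> r \<le> y + e"
    then have r: "y + e < r" by simp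
    have "e * e \<le> (y + e) * e" using nonneg by (intro mult_right_mono) auto
    also have "\<dots> \<le> (y + e) * (r - y)" using nonneg r by (intro mult_left_mono) auto
    also have "\<dots> < r * (r - y)" using nonneg r by (intro mult_strict_right_mono) auto
    finally show False using bound by (simp add: algebra_simps)
  qed
  then have "y * r \<le> y * (y + e)" using nonneg by (intro mult_left_mono)
  moreover have "sqrt (E * Y) = e * y" by (simp add: e_def y_def real_sqrt_mult)
  ultimately show ?thesis using bound sq by (simp add: algebra_simps)
qed

text \<open>Jensen's inequality for the square root, read off from the nonnegative variance of
  \<open>sqrt (f x)\<close>.\<close>

lemma expectation_sqrt_le:
  assumes fin: "finite (set_pmf D)" and nonneg: "\<And>x. x \<in> set_pmf D \<Longrightarrow> 0 \<le> f x"
  shows "measure_pmf.expectation D (\<lambda>x. sqrt (f x)) \<le> sqrt (measure_pmf.expectation D f)"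
proof -
  have int: "integrable D g" for g :: "_ \<Rightarrow> real" by (rule integrable_measure_pmf_finite[OF fin])
  have "0 \<le> measure_pmf.variance D (\<lambda>x. sqrt (f x))" by (rule measure_pmf.variance_positive)
  also have "\<dots> = measure_pmf.expectation D (\<lambda>x. (sqrt (f x))\<^sup>2) - (measure_pmf.expectation D (\<lambda>x. sqrt (f x)))\<^sup>2"
    by (intro measure_pmf.variance_eq int)
  also have "measure_pmf.expectation D (\<lambda>x. (sqrt (f x))\<^sup>2) = measure_pmf.expectation D f"
    using nonneg by (intro integral_cong_AE) (auto simp: AE_measure_pmf_iff)
  finally show ?thesis by (intro real_le_rsqrt) simp
qed

lemma expectation_pair_pmf_iterated:
  fixes f :: "'a \<times> 'b \<Rightarrow> real"
  assumes "finite (set_pmf p)" "finite (set_pmf q)"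
  shows "measure_pmf.expectation (pair_pmf p q) f =
    measure_pmf.expectation p (\<lambda>x. measure_pmf.expectation q (\<lambda>y. f (x, y)))"
proof -
  have "measure_pmf.expectation (pair_pmf p q) f =
      (\<Sum>z\<in>set_pmf p \<times> set_pmf q. f z * pmf (pair_pmf p q) z)"
    using assms by (intro integral_measure_pmf_real) auto
  also have "\<dots> = (\<Sum>x\<in>set_pmf p. \<Sum>y\<in>set_pmf q. f (x, y) * (pmf p x * pmf q y))"
    by (auto simp: sum.cartesian_product pmf_pair intro!: sum.cong)
  also have "\<dots> = (\<Sum>x\<in>set_pmf p. (\<Sum>y\<in>set_pmf q. f (x, y) * pmf q y) * pmf p x)"
    by (simp only: sum_distrib_right mult.assoc) (simp add: mult_ac)
  also have "\<dots> = measure_pmf.expectation p (\<lambda>x. measure_pmf.expectation q (\<lambda>y. f (x, y)))"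
    using assms by (simp add: integral_measure_pmf_real[of "set_pmf p"] integral_measure_pmf_real[of "set_pmf q"])
  finally show ?thesis .
qed

definition swap_on :: "'j set \<Rightarrow> ('j \<Rightarrow> 'c) \<times> ('j \<Rightarrow> 'c) \<Rightarrow> ('j \<Rightarrow> 'c) \<times> ('j \<Rightarrow> 'c)" where
  "swap_on S x = ((\<lambda>j. if j \<in> S then snd x j else fst x j), (\<lambda>j. if j \<in> S then fst x j else snd x j))"

lemma swap_on_swap_on [simp]: "swap_on S (swap_on S x) = x"
  by (cases x) (auto simp: swap_on_def fun_eq_iff)

text \<open>Each pair \<open>(g j, g' j)\<close> consists of independent copies and is exchangeable,
  and different \<open>j\<close> are independent. Off \<open>J\<close> both functions carry the
  default \<open>d\<close>, and \<open>S \<subseteq> J\<close> leaves it in place.\<close>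

lemma map_pmf_swap_on:
  assumes J: "finite J" "S \<subseteq> J"
  shows "map_pmf (swap_on S) (pair_pmf (Pi_pmf J d p) (Pi_pmf J d p)) = pair_pmf (Pi_pmf J d p) (Pi_pmf J d p)"
    (is "map_pmf _ ?M = _")
proof (rule pmf_eqI)
  fix x :: "('a \<Rightarrow> 'b) \<times> ('a \<Rightarrow> 'b)"
  obtain g g' where x: "x = (g, g')" by (cases x)
  have "inj (swap_on S)" by (metis injI swap_on_swap_on)
  then have "pmf (map_pmf (swap_on S) ?M) x = pmf ?M (swap_on S x)"
    using pmf_map_inj'[of "swap_on S" ?M "swap_on S x"] by simp
  also have "\<dots> = pmf ?M x"
  proof (cases "\<forall>j. j \<notin> J \<longrightarrow> g j = d \<and> g' j = d")
    case True
    then show ?thesis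
      using J by (subst (1 2) x, simp add: swap_on_def pmf_pair pmf_Pi subset_iff flip: prod.distrib)
        (auto intro!: prod.cong)
  next
    case False
    then obtain j where j: "j \<notin> J" "g j \<noteq> d \<or> g' j \<noteq> d" by auto
    with J have "j \<notin> S" by auto
    with j J show ?thesis
      by (auto simp: x swap_on_def pmf_pair pmf_Pi)
  qed
  finally show "pmf (map_pmf (swap_on S) ?M) x = pmf ?M x" .
qed

text \<open>The process is not centred: comparison with an independent copy costs the maximum of the
  expectations, which is the quantity called \<open>E\<close> in the final theorem.\<close>

lemma expected_max_symmetrization:
  fixes f :: "'j \<Rightarrow> 'c \<Rightarrow> 't \<Rightarrow> real" and d :: 'c and p :: "'j \<Rightarrow> 'c pmf"
  assumes J: "finite J" and T: "finite T" "T \<noteq> {}" and p: "\<And>j. j \<in> J \<Longrightarrow> finite (set_pmf (p j))"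
  defines "D \<equiv> Pi_pmf J d p"
  shows "measure_pmf.expectation D (\<lambda>g. MAX t\<in>T. \<Sum>j\<in>J. f j (g j) t) \<le>
    (MAX t\<in>T. measure_pmf.expectation D (\<lambda>g. \<Sum>j\<in>J. f j (g j) t)) +
    2 * measure_pmf.expectation D (\<lambda>g. rademacher_max J T (\<lambda>t j. f j (g j) t))"
proof -
  define X where "X g t = (\<Sum>j\<in>J. f j (g j) t)" for g t
  \<comment> \<open>Swapping the coordinates in \<open>S\<close> of \<open>g\<close> and an independent copy \<open>g'\<close> preserves their joint law
    and flips the signs of the corresponding differences.\<close>
  define \<Psi> where "\<Psi> x = (MAX t\<in>T. X (fst x) t - X (snd x) t)" for x
  define R where "R S g = (MAX t\<in>T. \<Sum>j\<in>J. sgn_of S j * f j (g j) t)" for S g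
  define E where "E = (MAX t\<in>T. measure_pmf.expectation D (\<lambda>g. X g t))"
  define E2 where "E2 = measure_pmf.expectation (pair_pmf D D) \<Psi>"
  have fin: "finite (set_pmf D)"
    unfolding D_def using J p by (simp add: set_Pi_pmf finite_PiE_dflt)
  have int: "integrable D u" for u :: "_ \<Rightarrow> real" by (rule integrable_measure_pmf_finite[OF fin])
  have int2: "integrable (pair_pmf D D) u" for u :: "_ \<Rightarrow> real"
    using fin by (intro integrable_measure_pmf_finite) auto
  have ghost: "(MAX t\<in>T. X g t) \<le> measure_pmf.expectation D (\<lambda>g'. \<Psi> (g, g')) + E" for g
  proof (subst Max_le_iff; (intro ballI)?)
    fix v assume "v \<in> X g ` T"
    then obtain t where t: "t \<in> T" "v = X g t" by auto
    have "v = measure_pmf.expectation D (\<lambda>g'. X g t - X g' t) + measure_pmf.expectation D (\<lambda>g. X g t)"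
      using int by (simp add: t(2))
    also have "measure_pmf.expectation D (\<lambda>g'. X g t - X g' t) \<le> measure_pmf.expectation D (\<lambda>g'. \<Psi> (g, g'))"
      unfolding \<Psi>_def using T t by (intro integral_mono int Max_ge) auto
    also have "measure_pmf.expectation D (\<lambda>g. X g t) \<le> E"
      unfolding E_def using T t by (intro Max_ge) auto
    finally show "v \<le> measure_pmf.expectation D (\<lambda>g'. \<Psi> (g, g')) + E" by simp
  qed (use T in auto)
  have "measure_pmf.expectation D (\<lambda>g. MAX t\<in>T. X g t) \<le>
      measure_pmf.expectation D (\<lambda>g. measure_pmf.expectation D (\<lambda>g'. \<Psi> (g, g')) + E)"
    by (intro integral_mono int ghost)
  also have "\<dots> = E2 + E"
    unfolding E2_def by (simp add: int expectation_pair_pmf_iterated[OF fin fin])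
  finally have decoupled: "measure_pmf.expectation D (\<lambda>g. MAX t\<in>T. X g t) \<le> E2 + E" .
  \<comment> \<open>After the swap the second copy carries the signs of \<open>S\<close> and the
    first those of \<open>J - S\<close>. The maximum of a sum is at most the sum of the maxima,
    which separates the copies.\<close>
  have swapped: "E2 \<le> measure_pmf.expectation D (R (J - S)) + measure_pmf.expectation D (R S)"
    if S: "S \<in> Pow J" for S
  proof -
    have "E2 = measure_pmf.expectation (map_pmf (swap_on S) (pair_pmf D D)) \<Psi>"
      unfolding E2_def D_def using S J by (subst map_pmf_swap_on) auto
    also have "\<dots> = measure_pmf.expectation (pair_pmf D D) (\<lambda>x. \<Psi> (swap_on S x))" by simp
    also have "\<dots> \<le> measure_pmf.expectation (pair_pmf D D) (\<lambda>x. R (J - S) (fst x) + R S (snd x))"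
    proof (intro integral_mono int2)
      fix x :: "('j \<Rightarrow> 'c) \<times> ('j \<Rightarrow> 'c)"
      show "\<Psi> (swap_on S x) \<le> R (J - S) (fst x) + R S (snd x)"
        unfolding \<Psi>_def
      proof (subst Max_le_iff; (intro ballI)?)
        fix v assume "v \<in> (\<lambda>t. X (fst (swap_on S x)) t - X (snd (swap_on S x)) t) ` T"
        then obtain t where t: "t \<in> T" "v = X (fst (swap_on S x)) t - X (snd (swap_on S x)) t" by auto
        have "v = (\<Sum>j\<in>J. sgn_of (J - S) j * f j (fst x j) t) + (\<Sum>j\<in>J. sgn_of S j * f j (snd x j) t)"
          unfolding t(2) X_def sum_subtractf[symmetric] sum.distrib[symmetric]
          by (intro sum.cong) (auto simp: swap_on_def sgn_of_def)
        also have "\<dots> \<le> R (J - S) (fst x) + R S (snd x)"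
          unfolding R_def using T t(1) by (intro add_mono Max_ge) auto
        finally show "v \<le> R (J - S) (fst x) + R S (snd x)" .
      qed (use T in auto)
    qed
    also have "\<dots> = measure_pmf.expectation D (R (J - S)) + measure_pmf.expectation D (R S)"
      by (subst Bochner_Integration.integral_add) (auto intro: int2)
    finally show ?thesis .
  qed
  have "2 ^ card J * E2 = (\<Sum>S\<in>Pow J. E2)" using J by (simp add: card_Pow)
  also have "\<dots> \<le> (\<Sum>S\<in>Pow J. measure_pmf.expectation D (R (J - S)) + measure_pmf.expectation D (R S))"
    by (intro sum_mono swapped)
  also have "\<dots> = (\<Sum>S\<in>Pow J. measure_pmf.expectation D (R (J - S))) + (\<Sum>S\<in>Pow J. measure_pmf.expectation D (R S))"
    by (rule sum.distrib)
  \<comment> \<open>Complementation permutes \<open>Pow J\<close>, so both copies contribute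
    equally; hence the factor \<open>2\<close>.\<close>
  also have "(\<Sum>S\<in>Pow J. measure_pmf.expectation D (R (J - S))) = (\<Sum>S\<in>Pow J. measure_pmf.expectation D (R S))"
    by (rule sum.reindex_bij_witness[of _ "\<lambda>S. J - S" "\<lambda>S. J - S"]) (auto simp: double_diff)
  also have "(\<Sum>S\<in>Pow J. measure_pmf.expectation D (R S)) = measure_pmf.expectation D (\<lambda>g. \<Sum>S\<in>Pow J. R S g)"
    by (rule Bochner_Integration.integral_sum[symmetric]) (rule int)
  also have "\<dots> = measure_pmf.expectation D (\<lambda>g. 2 ^ card J * rademacher_max J T (\<lambda>t j. f j (g j) t))"
    unfolding R_def rademacher_max_def by simp
  also have "\<dots> = 2 ^ card J * measure_pmf.expectation D (\<lambda>g. rademacher_max J T (\<lambda>t j. f j (g j) t))"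
    by simp
  finally have "2 ^ card J * E2 \<le> 2 ^ card J * (2 * measure_pmf.expectation D (\<lambda>g. rademacher_max J T (\<lambda>t j. f j (g j) t)))"
    by simp
  then have "E2 \<le> 2 * measure_pmf.expectation D (\<lambda>g. rademacher_max J T (\<lambda>t j. f j (g j) t))"
    by (rule mult_left_le_imp_le) simp
  with decoupled show ?thesis unfolding X_def E_def by linarith
qed

text \<open>The mass of a point is the probability of an intersection of events, one for each
  variable, and factorises by independence. The value \<open>d\<close> off \<open>J\<close> matches
  the default of the product law.\<close>

lemma map_pmf_indep_vars_eq_Pi_pmf:
  assumes J: "finite J" "J \<noteq> {}"
    and indep: "prob_space.indep_vars (measure_pmf P) (\<lambda>_. count_space UNIV) X J"
  shows "map_pmf (\<lambda>\<omega> j. if j \<in> J then X j \<omega> else d) P = Pi_pmf J d (\<lambda>j. map_pmf (X j) P)"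
proof (rule pmf_eqI)
  fix g
  show "pmf (map_pmf (\<lambda>\<omega> j. if j \<in> J then X j \<omega> else d) P) g = pmf (Pi_pmf J d (\<lambda>j. map_pmf (X j) P)) g"
  proof (cases "\<forall>j. j \<notin> J \<longrightarrow> g j = d")
    case True
    then have "(\<lambda>\<omega> j. if j \<in> J then X j \<omega> else d) -` {g} = (\<Inter>j\<in>J. X j -` {g j})"
      using J by (auto simp: fun_eq_iff)
    moreover have "measure_pmf.prob P (\<Inter>j\<in>J. X j -` {g j}) = (\<Prod>j\<in>J. measure_pmf.prob P (X j -` {g j}))"
      using prob_space.indep_varsD_finite[OF prob_space_measure_pmf indep J(2,1), of "\<lambda>j. {g j}"] by simp
    ultimately show ?thesis using True J by (simp add: pmf_Pi pmf_map)
  next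
    case False
    then have "(\<lambda>\<omega> j. if j \<in> J then X j \<omega> else d) -` {g} = {}"
      by (auto simp: fun_eq_iff)
    with False J show ?thesis by (auto simp: pmf_Pi pmf_map)
  qed
qed

subsection \<open>Random linear codes\<close>

lemma Max_Max_swap:
  fixes a :: "'s \<Rightarrow> 't \<Rightarrow> 'l :: linorder"
  assumes "finite S" "S \<noteq> {}" "finite T" "T \<noteq> {}"
  shows "(MAX s\<in>S. MAX t\<in>T. a s t) = (MAX t\<in>T. MAX s\<in>S. a s t)"
proof -
  have le: "(MAX s\<in>S. MAX t\<in>T. a s t) \<le> (MAX t\<in>T. MAX s\<in>S. a s t)"
    if "finite S" "S \<noteq> {}" "finite T" "T \<noteq> {}" for S T and a :: "'c \<Rightarrow> 'd \<Rightarrow> 'l"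
  proof -
    have "a s t \<le> (MAX t\<in>T. MAX s\<in>S. a s t)" if st: "s \<in> S" "t \<in> T" for s t
    proof -
      have "a s t \<le> (MAX s\<in>S. a s t)" using that \<open>finite S\<close> by (intro Max_ge) auto
      also have "\<dots> \<le> (MAX t\<in>T. MAX s\<in>S. a s t)" using that \<open>finite T\<close> by (intro Max_ge) auto
      finally show ?thesis .
    qed
    then show ?thesis using that by (auto simp: Max_le_iff)
  qed
  show ?thesis by (intro antisym le assms)
qed

lemma sum_card_eq_count:
  fixes v :: "'x \<Rightarrow> 'j \<Rightarrow> 'b"
  assumes "finite A" "finite J"
  shows "(\<Sum>x\<in>A. card {j \<in> J. v x j = z j}) = (\<Sum>j\<in>J. card {x \<in> A. v x j = z j})"
proof -
  have "(\<Sum>x\<in>A. card {j \<in> J. v x j = z j}) = (\<Sum>x\<in>A. \<Sum>j\<in>J. if v x j = z j then 1 else 0)"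
    using assms by (simp add: sum.If_cases Int_def)
  also have "\<dots> = (\<Sum>j\<in>J. \<Sum>x\<in>A. if v x j = z j then 1 else 0)" by (rule sum.swap)
  also have "\<dots> = (\<Sum>j\<in>J. card {x \<in> A. v x j = z j})"
    using assms by (simp add: sum.If_cases Int_def)
  finally show ?thesis .
qed

lemma (in ring) finite_vectors: "finite (carrier R) \<Longrightarrow> finite (vectors R n)"
  unfolding vectors_def by (intro finite_PiE) auto

lemma (in ring) vectors_nonempty: "vectors R n \<noteq> {}"
  unfolding vectors_def by (auto simp: PiE_eq_empty_iff)

text \<open>After double counting, each coordinate of \<open>z\<close> is optimised separately. A
  best symbol occurs in some codeword and so lies in the carrier, which makes the optimal
  \<open>z\<close> admissible.\<close>

lemma (in ring) Max_total_agr_eq: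
  assumes fin: "finite (carrier R)" and A: "finite A" "A \<noteq> {}"
    and enc: "\<And>x j. x \<in> A \<Longrightarrow> j \<in> {1..n} \<Longrightarrow> encode R k n G x j \<in> carrier R"
  shows "(MAX z\<in>vectors R n. total_agr R k n G A z) = (\<Sum>j\<in>{1..n}. plurality A (\<lambda>x. encode R k n G x j))"
proof -
  have count: "total_agr R k n G A z = (\<Sum>j\<in>{1..n}. card {x \<in> A. encode R k n G x j = z j})" for z
    unfolding total_agr_def agr_def using A by (intro sum_card_eq_count) auto
  have "\<forall>j. \<exists>\<alpha>. \<alpha> \<in> (\<lambda>x. encode R k n G x j) ` A \<and>
      card {x \<in> A. encode R k n G x j = \<alpha>} = plurality A (\<lambda>x. encode R k n G x j)"
  proof
    fix j
    show "\<exists>\<alpha>. \<alpha> \<in> (\<lambda>x. encode R k n G x j) ` A \<and>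
      card {x \<in> A. encode R k n G x j = \<alpha>} = plurality A (\<lambda>x. encode R k n G x j)"
      by (rule plurality_attained[OF A, of "\<lambda>x. encode R k n G x j"]) blast
  qed
  from choice[OF this] obtain \<alpha> where "\<forall>j. \<alpha> j \<in> (\<lambda>x. encode R k n G x j) ` A \<and>
      card {x \<in> A. encode R k n G x j = \<alpha> j} = plurality A (\<lambda>x. encode R k n G x j)" by blast
  then have \<alpha>: "\<alpha> j \<in> (\<lambda>x. encode R k n G x j) ` A"
    "card {x \<in> A. encode R k n G x j = \<alpha> j} = plurality A (\<lambda>x. encode R k n G x j)" for j
    by blast+
  define z where "z = restrict \<alpha> {1..n}"
  have "\<alpha> j \<in> carrier R" if "j \<in> {1..n}" for j
  proof -
    obtain x where "x \<in> A" "\<alpha> j = encode R k n G x j" using \<alpha>(1)[of j] by (elim imageE)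
    with enc[OF _ that] show ?thesis by simp
  qed
  then have "z \<in> vectors R n"
    unfolding vectors_def z_def by (intro restrict_PiE_iff[THEN iffD2]) blast
  moreover have "total_agr R k n G A z = (\<Sum>j\<in>{1..n}. plurality A (\<lambda>x. encode R k n G x j))"
    unfolding count by (intro sum.cong) (auto simp: z_def \<alpha>(2))
  moreover have "total_agr R k n G A z \<le> (\<Sum>j\<in>{1..n}. plurality A (\<lambda>x. encode R k n G x j))" for z
    unfolding count using A by (intro sum_mono count_le_plurality)
  ultimately show ?thesis
    using finite_vectors[OF fin] by (intro Max_eqI) (auto intro: rev_image_eqI)
qed

text \<open>Isolates the dependence of a code symbol on a single column, so that symbol
  \<open>j\<close> is a function of the \<open>j\<close>-th independent variable.\<close>

definition col_eval :: "('a, 'b) ring_scheme \<Rightarrow> nat \<Rightarrow> (nat \<Rightarrow> 'a) \<Rightarrow> (nat \<Rightarrow> 'a) \<Rightarrow> 'a" where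
  "col_eval F k c x = finsum F (\<lambda>i. x i \<otimes>\<^bsub>F\<^esub> c i) {1..k}"

lemma (in ring) encode_eq_col_eval:
  assumes "G \<in> matrices R k n" "x \<in> vectors R k" "j \<in> {1..n}"
  shows "encode R k n G x j = col_eval R k (mat_col k G j) x" "encode R k n G x j \<in> carrier R"
proof -
  have carr: "x i \<in> carrier R" "G i j \<in> carrier R" if "i \<in> {1..k}" for i
    using assms that by (auto simp: matrices_def vectors_def PiE_iff)
  show "encode R k n G x j = col_eval R k (mat_col k G j) x"
    unfolding encode_def col_eval_def using assms carr
    by (simp add: mat_col_def) (intro finsum_cong', auto)
  show "encode R k n G x j \<in> carrier R"
    unfolding encode_def using assms carr by (auto intro!: finsum_closed)
qed

text \<open>Symmetrization, chaining for fixed columns, and Jensen's inequality bound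
  \<open>Q\<close> by \<open>E\<close> plus a multiple of \<open>sqrt Q\<close>; the resulting
  inequality is then solved.\<close>

lemma expected_max_sum_plurality_le:
  fixes D :: "('j \<Rightarrow> 'c) pmf" and h :: "'c \<Rightarrow> 'x \<Rightarrow> 'b"
  assumes J: "finite J" "J \<noteq> {}" and X: "finite X" and L: "2 \<le> L" "L \<le> card X"
    and p: "\<And>j. j \<in> J \<Longrightarrow> finite (set_pmf (p j))" and D: "D = Pi_pmf J d p"
  defines "T \<equiv> {\<Lambda>. \<Lambda> \<subseteq> X \<and> card \<Lambda> = L}"
  defines "S \<equiv> \<lambda>g \<Lambda>. \<Sum>j\<in>J. real (plurality \<Lambda> (h (g j)))"
  defines "Q \<equiv> measure_pmf.expectation D (\<lambda>g. MAX \<Lambda>\<in>T. S g \<Lambda>)"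
  defines "E \<equiv> MAX \<Lambda>\<in>T. measure_pmf.expectation D (\<lambda>g. S g \<Lambda>)"
  defines "Y \<equiv> 48000 * real L * log 2 (real (card X)) * log 2 (real L) ^ 5"
  shows "Q \<le> E + Y + sqrt (E * Y)"
proof -
  define K where "K = 12000 * real L * ln (real (card X)) * log 2 (real L) ^ 3"
  have log_ge: "1 \<le> log 2 (real L)" using L by (simp add: le_log_iff)
  have lnN: "0 < ln (real (card X))" using L by simp
  have K: "0 \<le> K" "0 \<le> Y" unfolding K_def Y_def using log_ge lnN L by auto
  \<comment> \<open>The \<open>4\<close> is the symmetrization factor \<open>2\<close> moved under
    the root. The exponent rises from \<open>3\<close> to \<open>5\<close> because
    \<open>log 2 L \<ge> 1\<close>.\<close>
  have KY: "4 * K \<le> Y"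
  proof -
    have "ln (real (card X)) * ln 2 \<le> ln (real (card X)) * 1"
      using lnN ln_2_less_1 by (intro mult_left_mono) auto
    then have "ln (real (card X)) \<le> log 2 (real (card X))" unfolding log_def by (simp add: field_simps)
    moreover have "log 2 (real L) ^ 3 \<le> log 2 (real L) ^ 5"
      using log_ge by (intro power_increasing) auto
    ultimately show ?thesis
      unfolding K_def Y_def using lnN log_ge
      by (auto intro!: mult_mono simp flip: mult.assoc)
  qed
  have T: "finite T" "T \<noteq> {}"
  proof -
    show "finite T" unfolding T_def using X by (auto intro: finite_subset[of _ "Pow X"])
    show "T \<noteq> {}" using obtain_subset_with_card_n[OF L(2)] unfolding T_def by blast
  qed
  have fin: "finite (set_pmf D)"
    unfolding D using J p by (simp add: set_Pi_pmf finite_PiE_dflt)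
  have int: "integrable D u" for u :: "_ \<Rightarrow> real" by (rule integrable_measure_pmf_finite[OF fin])
  have S: "0 \<le> S g \<Lambda>" for g \<Lambda> unfolding S_def by (intro sum_nonneg) auto
  have M: "0 \<le> (MAX \<Lambda>\<in>T. S g \<Lambda>)" for g using T S by (auto simp: Max_ge_iff)
  have E: "0 \<le> E" unfolding E_def using T S by (auto simp: Max_ge_iff intro!: Bochner_Integration.integral_nonneg)
  have Q: "0 \<le> Q" unfolding Q_def using M by (intro Bochner_Integration.integral_nonneg) auto
  have "Q \<le> E + 2 * measure_pmf.expectation D (\<lambda>g. rademacher_max J T (\<lambda>\<Lambda> j. real (plurality \<Lambda> (h (g j)))))"
    unfolding Q_def E_def S_def D using J T p by (intro expected_max_symmetrization) auto
  also have "measure_pmf.expectation D (\<lambda>g. rademacher_max J T (\<lambda>\<Lambda> j. real (plurality \<Lambda> (h (g j))))) \<le>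
      measure_pmf.expectation D (\<lambda>g. sqrt (K * (MAX \<Lambda>\<in>T. S g \<Lambda>)))"
  proof (intro integral_mono int)
    fix g
    \<comment> \<open>With \<open>g\<close> fixed, chaining is applied with the maximum for this
      very \<open>g\<close> as its bound, so that \<open>Q\<close> itself reappears after
      averaging.\<close>
    have "(\<Sum>j\<in>J. real (plurality \<Lambda> (h (g j)))) \<le> (MAX \<Lambda>\<in>T. S g \<Lambda>)" if "\<Lambda> \<in> T" for \<Lambda>
      using T that unfolding S_def by (intro Max_ge) auto
    then show "rademacher_max J T (\<lambda>\<Lambda> j. real (plurality \<Lambda> (h (g j)))) \<le> sqrt (K * (MAX \<Lambda>\<in>T. S g \<Lambda>))"
      unfolding K_def T_def by (intro rademacher_max_plurality_le J X L) auto
  qed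
  also have "\<dots> \<le> sqrt (measure_pmf.expectation D (\<lambda>g. K * (MAX \<Lambda>\<in>T. S g \<Lambda>)))"
    using K M fin by (intro expectation_sqrt_le) auto
  also have "\<dots> = sqrt (K * Q)" unfolding Q_def by simp
  also have "E + 2 * sqrt (K * Q) = E + sqrt (4 * K * Q)" by (simp add: real_sqrt_mult)
  also have "\<dots> \<le> E + sqrt (Y * Q)" using KY Q by (simp add: mult_right_mono)
  finally show ?thesis using E K Q by (intro le_if_le_add_sqrt) auto
qed

theorem theorem2:
  "\<exists>C0::real. C0 > 0 \<and>
     (\<forall>(F :: nat ring) (q::nat) (k::nat) (n::nat) (N::nat) (L::nat) (P :: (nat \<Rightarrow> nat \<Rightarrow> nat) pmf).
        primepow q \<longrightarrow> field F \<longrightarrow> finite (carrier F) \<longrightarrow> card (carrier F) = q \<longrightarrow>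
        k \<ge> 1 \<longrightarrow> n \<ge> 1 \<longrightarrow> N = q ^ k \<longrightarrow> 1 \<le> L \<longrightarrow> L \<le> N \<longrightarrow>
        indep_symbols_law F k n P \<longrightarrow>
        (let E = max_expected_agr F k n L P;
             Y = C0 * real L * log 2 (real N) * (log 2 (real L)) ^ 5
         in expected_max_agr F k n L P \<le> E + Y + sqrt (E * Y)))"
proof (intro exI[of _ 48000] conjI allI impI)
  fix F :: "nat ring" and q k n N L :: nat and P :: "(nat \<Rightarrow> nat \<Rightarrow> nat) pmf"
  assume F: "field F" and fin: "finite (carrier F)" and q: "card (carrier F) = q"
    and n: "1 \<le> n" and N: "N = q ^ k" and L: "1 \<le> L" "L \<le> N" and law: "indep_symbols_law F k n P"
  interpret field F by (rule F)
  define J where "J = {1..n}"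
  define X where "X = vectors F k"
  define T where "T = {\<Lambda>. \<Lambda> \<subseteq> X \<and> card \<Lambda> = L}"
  \<comment> \<open>Columns outside \<open>J\<close> are set to \<open>undefined\<close>, the
    default of the product law below.\<close>
  define \<phi> where "\<phi> G j = (if j \<in> J then mat_col k G j else undefined)" for G :: "nat \<Rightarrow> nat \<Rightarrow> nat" and j
  define D where "D = map_pmf \<phi> P"
  define S where "S g \<Lambda> = (\<Sum>j\<in>J. real (plurality \<Lambda> (col_eval F k (g j))))" for g \<Lambda>
  have J: "finite J" "J \<noteq> {}" using n by (auto simp: J_def)
  have X: "finite X" "card X = N"
    unfolding X_def N using finite_vectors[OF fin] q by (auto simp: vectors_def card_funcsetE)
  have T: "finite T" "T \<noteq> {}"
  proof -
    show "finite T" unfolding T_def using X by (auto intro: finite_subset[of _ "Pow X"])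
    show "T \<noteq> {}" using obtain_subset_with_card_n[of L X] L X unfolding T_def by blast
  qed
  have TD: "finite \<Lambda>" "\<Lambda> \<noteq> {}" "card \<Lambda> = L" "\<Lambda> \<subseteq> vectors F k" if "\<Lambda> \<in> T" for \<Lambda>
    using that X L finite_subset unfolding T_def X_def by auto
  have msg: "message_sets F k L = T" by (simp add: message_sets_def T_def X_def)
  have P: "set_pmf P \<subseteq> matrices F k n" using law by (simp add: indep_symbols_law_def)
  have finP: "finite (set_pmf P)"
    using P by (rule finite_subset) (auto simp: matrices_def intro!: finite_PiE finite_vectors fin)
  have D: "D = Pi_pmf J undefined (\<lambda>j. map_pmf (\<lambda>G. mat_col k G j) P)"
    unfolding D_def \<phi>_def[abs_def] using law J
    by (intro map_pmf_indep_vars_eq_Pi_pmf) (auto simp: indep_symbols_law_def J_def)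
  have single: "real (MAX z\<in>vectors F n. total_agr F k n G \<Lambda> z) = S (\<phi> G) \<Lambda>"
    if G: "G \<in> set_pmf P" and \<Lambda>: "\<Lambda> \<in> T" for G \<Lambda>
  proof -
    have enc: "encode F k n G x j = col_eval F k (\<phi> G j) x" "encode F k n G x j \<in> carrier F"
      if "x \<in> \<Lambda>" "j \<in> {1..n}" for x j
    proof -
      have "G \<in> matrices F k n" "x \<in> vectors F k" using P G TD(4)[OF \<Lambda>] that(1) by auto
      note col = encode_eq_col_eval[OF this that(2)]
      show "encode F k n G x j = col_eval F k (\<phi> G j) x" using col(1) that(2) by (simp add: \<phi>_def J_def)
      show "encode F k n G x j \<in> carrier F" by (rule col(2))
    qed
    have "(MAX z\<in>vectors F n. total_agr F k n G \<Lambda> z) = (\<Sum>j\<in>{1..n}. plurality \<Lambda> (\<lambda>x. encode F k n G x j))"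
      using enc(2) TD[OF \<Lambda>] fin by (intro Max_total_agr_eq) auto
    also have "\<dots> = (\<Sum>j\<in>{1..n}. plurality \<Lambda> (col_eval F k (\<phi> G j)))"
      by (intro sum.cong plurality_cong enc(1)) auto
    finally show ?thesis by (simp add: S_def J_def)
  qed
  have E: "max_expected_agr F k n L P = (MAX \<Lambda>\<in>T. measure_pmf.expectation D (\<lambda>g. S g \<Lambda>))"
    unfolding max_expected_agr_def msg D_def integral_map_pmf
    by (intro arg_cong[of _ _ Max] image_cong integral_cong_AE) (auto simp: AE_measure_pmf_iff single)
  have Q: "expected_max_agr F k n L P = measure_pmf.expectation D (\<lambda>g. MAX \<Lambda>\<in>T. S g \<Lambda>)"
    unfolding expected_max_agr_def msg D_def integral_map_pmf
  proof (intro integral_cong_AE AE_pmfI)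
    fix G assume G: "G \<in> set_pmf P"
    \<comment> \<open>With the maximum over \<open>z\<close> innermost, it can be evaluated as a sum
      of pluralities.\<close>
    have "(MAX z\<in>vectors F n. MAX \<Lambda>\<in>T. total_agr F k n G \<Lambda> z) =
        (MAX \<Lambda>\<in>T. MAX z\<in>vectors F n. total_agr F k n G \<Lambda> z)"
      using T finite_vectors[OF fin] vectors_nonempty by (intro Max_Max_swap) auto
    also have "real \<dots> = (MAX \<Lambda>\<in>T. real (MAX z\<in>vectors F n. total_agr F k n G \<Lambda> z))"
      using T by (subst mono_Max_commute[of real]) (auto simp: mono_def image_image)
    also have "\<dots> = (MAX \<Lambda>\<in>T. S (\<phi> G) \<Lambda>)"
      using single[OF G] by (intro arg_cong[of _ _ Max] image_cong) auto
    finally show "real (MAX z\<in>vectors F n. MAX \<Lambda>\<in>T. total_agr F k n G \<Lambda> z) = (MAX \<Lambda>\<in>T. S (\<phi> G) \<Lambda>)" .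
  qed auto
  show "let E = max_expected_agr F k n L P; Y = 48000 * real L * log 2 (real N) * log 2 (real L) ^ 5
      in expected_max_agr F k n L P \<le> E + Y + sqrt (E * Y)"
  proof (cases "L = 1")
    \<comment> \<open>The chaining bound starts at \<open>L = 2\<close>. For \<open>L = 1\<close>
      the logarithm makes \<open>Y = 0\<close>, and both sides equal \<open>n\<close> since every
      plurality is \<open>1\<close>.\<close>
    case True
    have "plurality \<Lambda> u = 1" if "\<Lambda> \<in> T" for \<Lambda> and u :: "_ \<Rightarrow> nat"
      using plurality_ge_1[of \<Lambda> u] plurality_le_card[of \<Lambda> u] TD[OF that] True by simp
    then have "S g \<Lambda> = real n" if "\<Lambda> \<in> T" for g \<Lambda>
      using that by (simp add: S_def J_def)
    then have "(MAX \<Lambda>\<in>T. measure_pmf.expectation D (\<lambda>g. S g \<Lambda>)) = real n"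
      "(MAX \<Lambda>\<in>T. S g \<Lambda>) = real n" for g
      using T by (simp_all cong: image_cong_simp)
    then show ?thesis unfolding E Q using True by simp
  next
    case False
    have "measure_pmf.expectation D (\<lambda>g. MAX \<Lambda>\<in>T. S g \<Lambda>) \<le>
        (MAX \<Lambda>\<in>T. measure_pmf.expectation D (\<lambda>g. S g \<Lambda>)) +
        48000 * real L * log 2 (real (card X)) * log 2 (real L) ^ 5 +
        sqrt ((MAX \<Lambda>\<in>T. measure_pmf.expectation D (\<lambda>g. S g \<Lambda>)) *
          (48000 * real L * log 2 (real (card X)) * log 2 (real L) ^ 5))"
      unfolding S_def T_def using False L X finP
      by (intro expected_max_sum_plurality_le[OF J X(1) _ _ _ D]) auto
    then show ?thesis unfolding E Q Let_def X(2) .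
  qed
qed simp

end
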